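(* Let $n\ge 3$ and $d,e\in TP(n)$. Then $d$ and $e$ are adjacent extreme points of $\mathsf{DP(n)}$ if and only if $d$ and $e$ are comparable in the componentwise order and $|d-e|$ (componentwise absolute value) equals $\Omega_I$ for some nontrivial interval $I$ of $[n]$ or equals $\Omega_{I,J}$ for some disjoint pair of intervals $(I,J)$ of $[n]$.
   Context: $\mathsf{DP(n)}$ is the convex hull in $\mathbb{R}^n$ of all degree partitions (sorted weakly decreasing degree sequences) of simple graphs on $[n]$. A threshold graph is a simple graph every induced subgraph of which has a dominating or an isolated vertex; $TP(n)$ is the set of degree partitions of threshold graphs on $[n]$, ordered componentwise. An interval of $[n]$ is a nonempty set $\{i,i+1,\dots,j\}$; it is nontrivial if it has at least two elements. For a nontrivial interval $I$, $\Omega_I=(a_1,\dots,a_n)$ with $a_i=|I|-1$ for $i\in I$ and $a_i=0$ otherwise. For disjoint intervals $I,J$ with $\max I<\min J$, $\Omega_{I,J}=(a_1,\dots,a_n)$ with $a_i=|J|$ for $i\in I$, $a_i=|I|$ for $i\in J$, and $a_i=0$ otherwise. *)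

theory Defs
  imports "HOL-Analysis.Analysis"
begin

text \<open>
  A finite linearly ordered type \<open>'n\<close> plays the role of \<open>[n]\<close>, with \<open>n = CARD('n)\<close>: it indexes
  the coordinates of \<open>\<real>\<^sup>n\<close> (as \<open>real ^ 'n\<close>) and is the vertex set of the graphs. A simple graph
  on a vertex set \<open>V\<close> is given by its set \<open>E\<close> of edges, each of them a two-element subset of \<open>V\<close>.
\<close>

definition simple_graph :: "'a set \<Rightarrow> 'a set set \<Rightarrow> bool" where
  "simple_graph V E \<longleftrightarrow> (\<forall>e\<in>E. e \<subseteq> V \<and> card e = 2)"

definition induced_edges :: "'a set set \<Rightarrow> 'a set \<Rightarrow> 'a set set" where
  "induced_edges E U = {e \<in> E. e \<subseteq> U}"

definition vertex_degree :: "'a set set \<Rightarrow> 'a \<Rightarrow> nat" where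
  "vertex_degree E v = card {e \<in> E. v \<in> e}"

definition dominating_vertex :: "'a set \<Rightarrow> 'a set set \<Rightarrow> 'a \<Rightarrow> bool" where
  "dominating_vertex V E v \<longleftrightarrow> v \<in> V \<and> (\<forall>u \<in> V - {v}. {u, v} \<in> E)"

definition isolated_vertex :: "'a set \<Rightarrow> 'a set set \<Rightarrow> 'a \<Rightarrow> bool" where
  "isolated_vertex V E v \<longleftrightarrow> v \<in> V \<and> (\<forall>u \<in> V - {v}. {u, v} \<notin> E)"

text \<open>As usual, graphs (here: induced subgraphs) have a nonempty vertex set.\<close>

definition threshold_graph :: "'a set \<Rightarrow> 'a set set \<Rightarrow> bool" where
  "threshold_graph V E \<longleftrightarrow> simple_graph V E \<and>
     (\<forall>U. U \<subseteq> V \<and> U \<noteq> {} \<longrightarrow>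
       (\<exists>v. dominating_vertex U (induced_edges E U) v \<or> isolated_vertex U (induced_edges E U) v))"

text \<open>
  \<open>d\<close> is the degree partition of the graph \<open>E\<close>: the degree sequence rearranged in weakly
  decreasing order.
\<close>

definition is_degree_partition ::
    "('n::{finite,linorder}) set set \<Rightarrow> real ^ ('n::{finite,linorder}) \<Rightarrow> bool" where
  "is_degree_partition E d \<longleftrightarrow>
     (\<exists>p. bij p \<and> (\<forall>i. d $ i = real (vertex_degree E (p i)))) \<and> (\<forall>i j. i \<le> j \<longrightarrow> d $ j \<le> d $ i)"

definition DP :: "(real ^ ('n::{finite,linorder})) set" where
  "DP = convex hull {d. \<exists>E. simple_graph UNIV E \<and> is_degree_partition E d}"

definition TP :: "(real ^ ('n::{finite,linorder})) set" where
  "TP = {d. \<exists>E. threshold_graph UNIV E \<and> is_degree_partition E d}"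

definition adjacent_extreme_points ::
    "('a::euclidean_space) set \<Rightarrow> 'a \<Rightarrow> 'a \<Rightarrow> bool" where
  "adjacent_extreme_points P d e \<longleftrightarrow>
     d extreme_point_of P \<and> e extreme_point_of P \<and> closed_segment d e edge_of P"

definition index_interval :: "('n::{finite,linorder}) set \<Rightarrow> bool" where
  "index_interval I \<longleftrightarrow> (\<exists>i j. i \<le> j \<and> I = {i..j})"

definition nontrivial_interval :: "('n::{finite,linorder}) set \<Rightarrow> bool" where
  "nontrivial_interval I \<longleftrightarrow> index_interval I \<and> card I \<ge> 2"

definition disjoint_interval_pair ::
    "('n::{finite,linorder}) set \<Rightarrow> ('n::{finite,linorder}) set \<Rightarrow> bool" where
  "disjoint_interval_pair I J \<longleftrightarrow> index_interval I \<and> index_interval J \<and> Max I < Min J"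

definition Omega1 :: "('n::{finite,linorder}) set \<Rightarrow> real ^ ('n::{finite,linorder})" where
  "Omega1 I = (\<chi> i. if i \<in> I then real (card I) - 1 else 0)"

definition Omega2 ::
    "('n::{finite,linorder}) set \<Rightarrow> ('n::{finite,linorder}) set \<Rightarrow> real ^ ('n::{finite,linorder})" where
  "Omega2 I J = (\<chi> i. if i \<in> I then real (card J) else if i \<in> J then real (card I) else 0)"

end

theory Submission
  imports Defs
begin

text \<open>
  After relabelling, a threshold graph with weakly decreasing degrees is a \<^emph>\<open>shifted\<close> graph: replacing
  an endpoint of an edge by a smaller vertex gives an edge again. Degree minus rank exposes its degree
  vector as an extreme point of \<open>DP\<close>.

  If a functional \<open>c\<close> exposes the edge from \<open>d\<close> to \<open>e\<close>, project \<open>c\<close> to a decreasing vector \<open>b\<close>; this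
  changes no value on graphs that are defined by \<open>b\<close>, so \<open>{i, j}\<close> being an edge iff
  \<open>b\<^sub>i + b\<^sub>j > 0\<close> gives a maximiser. It remains one, and remains shifted, after adding all pairs with
  \<open>b\<^sub>i = v\<close>, \<open>b\<^sub>j = -v\<close>. Hence \<open>d\<close> and \<open>e\<close> are these two graphs, and the level sets of \<open>b\<close> at \<open>v\<close> and
  \<open>-v\<close> are intervals.

  Conversely, if \<open>d \<le> e\<close> differ by \<open>\<Omega>\<^sub>I\<close> or \<open>\<Omega>\<^sub>I\<^sub>J\<close>, then the graph of \<open>e\<close> arises from that of \<open>d\<close> by
  adding the complete graph on \<open>I\<close> or the complete bipartite graph between \<open>I\<close> and \<open>J\<close>. Suitable
  weights that are constant on the blocks, together with a penalty for degrees that are not, expose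
  the segment from \<open>d\<close> to \<open>e\<close>.
\<close>

subsection \<open>Shifted graphs\<close>

definition nbrs :: "'a set set \<Rightarrow> 'a \<Rightarrow> 'a set" where
  "nbrs E v = {u. {u, v} \<in> E}"

definition deg_vec :: "('n::finite) set set \<Rightarrow> real ^ 'n" where
  "deg_vec E = (\<chi> i. real (vertex_degree E i))"

text \<open>Up to relabelling by degree, these are exactly the threshold graphs.\<close>

definition shifted :: "('n::linorder) set set \<Rightarrow> bool" where
  "shifted E \<longleftrightarrow> simple_graph UNIV E \<and>
     (\<forall>i j k. i < j \<and> i \<noteq> k \<and> {j, k} \<in> E \<longrightarrow> {i, k} \<in> E)"

definition decreasing_vecs :: "(real ^ ('n::{finite,linorder})) set" where
  "decreasing_vecs = {x. \<forall>i j. i \<le> j \<longrightarrow> x $ j \<le> x $ i}"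

definition rk :: "('n::{finite,linorder}) \<Rightarrow> real" where
  "rk i = real (card {k. k < i})"

section \<open>Neighbourhoods, degrees and linear functionals of simple graphs\<close>

lemma simple_graphD:
  assumes "simple_graph UNIV E" "{u, v} \<in> E"
  shows "u \<noteq> v"
  using assms by (auto simp: simple_graph_def)

lemma simple_graph_subset: "simple_graph V E \<Longrightarrow> G \<subseteq> E \<Longrightarrow> simple_graph V G"
  by (auto simp: simple_graph_def)

lemma simple_graph_edgeE:
  assumes "simple_graph UNIV E" "e \<in> E"
  obtains u v where "e = {u, v}" "u \<noteq> v"
  using assms by (metis simple_graph_def card_2_iff)

lemma vertex_degree_eq_card_nbrs:
  fixes E :: "('n::finite) set set"
  assumes "simple_graph UNIV E"
  shows "vertex_degree E v = card (nbrs E v)"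
proof -
  have "bij_betw (\<lambda>u. {u, v}) (nbrs E v) {e \<in> E. v \<in> e}"
    unfolding bij_betw_def
  proof
    show "inj_on (\<lambda>u. {u, v}) (nbrs E v)"
      by (auto simp: inj_on_def doubleton_eq_iff)
    show "(\<lambda>u. {u, v}) ` nbrs E v = {e \<in> E. v \<in> e}"
    proof
      show "{e \<in> E. v \<in> e} \<subseteq> (\<lambda>u. {u, v}) ` nbrs E v"
      proof
        fix e assume e: "e \<in> {e \<in> E. v \<in> e}"
        then have "e \<in> E" by simp
        then obtain x y where "e = {x, y}" "x \<noteq> y"
          by (rule simple_graph_edgeE[OF assms])
        with e show "e \<in> (\<lambda>u. {u, v}) ` nbrs E v"
          by (auto simp: nbrs_def insert_commute)
      qed
    qed (auto simp: nbrs_def)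
  qed
  then show ?thesis
    by (simp add: vertex_degree_def bij_betw_same_card)
qed

lemma deg_vec_eq_card_nbrs:
  fixes E :: "('n::finite) set set"
  assumes "simple_graph UNIV E"
  shows "deg_vec E $ v = real (card (nbrs E v))"
  using vertex_degree_eq_card_nbrs[OF assms] by (simp add: deg_vec_def)

text \<open>Double counting of incidences. A linear functional of the degree vector becomes a sum of
  independent edge weights, so it can be maximised edge by edge.\<close>

lemma inner_deg_vec:
  fixes E :: "('n::finite) set set" and c :: "real ^ 'n"
  shows "c \<bullet> deg_vec E = (\<Sum>e\<in>E. \<Sum>k\<in>e. c $ k)"
proof -
  have "c \<bullet> deg_vec E = (\<Sum>k\<in>UNIV. \<Sum>e | e \<in> E \<and> k \<in> e. c $ k)"
    by (simp add: inner_vec_def deg_vec_def vertex_degree_def mult.commute)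
  also have "\<dots> = (\<Sum>e\<in>E. \<Sum>k | k \<in> UNIV \<and> k \<in> e. c $ k)"
    using sum.swap_restrict[of UNIV E "\<lambda>k e. c $ k" "\<lambda>k e. k \<in> e"] by simp
  finally show ?thesis by simp
qed

lemma deg_vec_Un:
  fixes D :: "('n::finite) set set"
  assumes "D \<inter> H = {}"
  shows "deg_vec (D \<union> H) = deg_vec D + deg_vec H"
proof -
  have "vertex_degree (D \<union> H) i = vertex_degree D i + vertex_degree H i" for i
  proof -
    have "{e \<in> D \<union> H. i \<in> e} = {e \<in> D. i \<in> e} \<union> {e \<in> H. i \<in> e}" by auto
    then show ?thesis
      using assms unfolding vertex_degree_def by (simp add: card_Un_disjoint disjoint_iff)
  qed
  then show ?thesis by (simp add: deg_vec_def vec_eq_iff)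
qed

text \<open>Going from \<open>G\<close> to \<open>D\<close> gains only nonnegative terms and loses
  only nonpositive ones; if the total is unchanged, each of these terms is zero. This certifies
  optimal graphs and restricts how other optimal ones can differ.\<close>

lemma sum_le_sum_positive_part:
  fixes s :: "'a \<Rightarrow> real"
  assumes "finite D" "finite G"
    and "\<And>e. e \<in> D \<Longrightarrow> s e \<ge> 0" "\<And>e. e \<in> G - D \<Longrightarrow> s e \<le> 0"
  shows "sum s G \<le> sum s D"
    and "sum s G = sum s D \<Longrightarrow> e \<in> (D - G) \<union> (G - D) \<Longrightarrow> s e = 0"
proof -
  have eq: "sum s D - sum s G = sum s (D - G) + sum (\<lambda>e. - s e) (G - D)"
    using sum.Int_Diff[OF assms(1), of s G] sum.Int_Diff[OF assms(2), of s D]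
    by (simp add: sum_negf Int_commute)
  have p: "sum s (D - G) \<ge> 0" "sum (\<lambda>e. - s e) (G - D) \<ge> 0"
    using assms(3,4) by (auto intro!: sum_nonneg)
  show "sum s G \<le> sum s D" using eq p by linarith
  assume "sum s G = sum s D" and e: "e \<in> (D - G) \<union> (G - D)"
  then have "sum s (D - G) = 0" "sum (\<lambda>e. - s e) (G - D) = 0" using eq p by linarith+
  then have "\<forall>e\<in>D - G. s e = 0" "\<forall>e\<in>G - D. - s e = 0"
    using assms by (subst (asm) sum_nonneg_eq_0_iff; force)+
  with e show "s e = 0" by auto
qed

lemma shiftedD:
  assumes "shifted E" "{j, k} \<in> E" "i \<le> j" "i \<noteq> k"
  shows "{i, k} \<in> E"
  using assms unfolding shifted_def by (metis order_le_less)

lemma shifted_deg_vec_mem_decreasing: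
  fixes E :: "('n::{finite,linorder}) set set"
  assumes "shifted E"
  shows "deg_vec E \<in> decreasing_vecs"
proof -
  have "deg_vec E $ j \<le> deg_vec E $ i" if "i < j" for i j
  proof -
    have sg: "simple_graph UNIV E" using assms by (simp add: shifted_def)
    define f where "f k = (if k = i then j else k)" for k
    have "inj_on f (nbrs E j)"
      using simple_graphD[OF sg] by (auto simp: f_def inj_on_def nbrs_def)
    moreover have "f ` nbrs E j \<subseteq> nbrs E i"
      using shiftedD[OF assms, of j _ i] that
      by (auto simp: f_def nbrs_def insert_commute)
    ultimately have "card (nbrs E j) \<le> card (nbrs E i)"
      by (meson card_inj_on_le finite)
    then show ?thesis by (simp add: deg_vec_eq_card_nbrs[OF sg])
  qed
  then show ?thesis by (auto simp: decreasing_vecs_def order_le_less)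
qed

lemma card_atMost_rk: "real (card {k. k \<le> (i::'n::{finite,linorder})}) = rk i + 1"
proof -
  have "{k. k \<le> i} = insert i {k. k < i}" by auto
  then show ?thesis by (simp add: rk_def)
qed

lemma card_interval_rk:
  assumes "a \<le> (b::'n::{finite,linorder})"
  shows "real (card {a..b}) = rk b - rk a + 1"
proof -
  have "{k. k \<le> b} = {k. k < a} \<union> {a..b}" "{k. k < a} \<inter> {a..b} = {}"
    using assms by auto
  then have "card {k. k \<le> b} = card {k. k < a} + card {a..b}"
    by (metis card_Un_disjoint finite)
  then show ?thesis using card_atMost_rk[of b] by (simp add: rk_def)
qed

text \<open>Every vertex up to \<open>i\<close> is adjacent to \<open>j\<close>, and every vertex up
  to \<open>j\<close> except \<open>i\<close> is adjacent to \<open>i\<close>. Ranks start at 0, so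
  these sets have \<open>rk i + 1\<close> and \<open>rk j\<close> elements.\<close>

lemma shifted_edge_bounds:
  fixes E :: "('n::{finite,linorder}) set set"
  assumes "shifted E" "i < j" "{i, j} \<in> E"
  shows "rk i + 1 \<le> deg_vec E $ j" "rk j \<le> deg_vec E $ i"
proof -
  have sg: "simple_graph UNIV E" using assms by (simp add: shifted_def)
  have "{k. k \<le> i} \<subseteq> nbrs E j"
    using shiftedD[OF assms(1,3)] assms(2) by (auto simp: nbrs_def)
  then have "card {k. k \<le> i} \<le> card (nbrs E j)" by (simp add: card_mono)
  then show "rk i + 1 \<le> deg_vec E $ j"
    using card_atMost_rk[of i] by (simp add: deg_vec_eq_card_nbrs[OF sg])
  have "{k. k \<le> j} - {i} \<subseteq> nbrs E i"
    using shiftedD[OF assms(1), of j i] assms(2,3) by (auto simp: nbrs_def insert_commute)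
  then have "card ({k. k \<le> j} - {i}) \<le> card (nbrs E i)" by (simp add: card_mono)
  then show "rk j \<le> deg_vec E $ i"
    using card_atMost_rk[of j] assms(2) by (simp add: deg_vec_eq_card_nbrs[OF sg])
qed

text \<open>Dual to the bounds for edges: the neighbours of \<open>j\<close> come before
  \<open>i\<close>; those of \<open>i\<close> come before \<open>j\<close> and exclude
  \<open>i\<close>, whence the extra 1.\<close>

lemma shifted_nonedge_bounds:
  fixes E :: "('n::{finite,linorder}) set set"
  assumes "shifted E" "i < j" "{i, j} \<notin> E"
  shows "deg_vec E $ j \<le> rk i" "deg_vec E $ i + 1 \<le> rk j"
proof -
  have sg: "simple_graph UNIV E" using assms by (simp add: shifted_def)
  have "nbrs E j \<subseteq> {k. k < i}"
  proof
    fix k assume k: "k \<in> nbrs E j"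
    then have "{k, j} \<in> E" by (simp add: nbrs_def)
    then show "k \<in> {k. k < i}"
      using shiftedD[OF assms(1), of k j i] assms(2,3) by force
  qed
  then have "card (nbrs E j) \<le> card {k. k < i}" by (simp add: card_mono)
  then show "deg_vec E $ j \<le> rk i"
    by (simp add: deg_vec_eq_card_nbrs[OF sg] rk_def)
  have "nbrs E i \<subseteq> {k. k < j} - {i}"
  proof
    fix k assume k: "k \<in> nbrs E i"
    then have "{k, i} \<in> E" by (simp add: nbrs_def)
    then show "k \<in> {k. k < j} - {i}"
      using shiftedD[OF assms(1), of k i j] assms(2,3) simple_graphD[OF sg, of k i]
      by (force simp: insert_commute)
  qed
  then have "card (nbrs E i) \<le> card ({k. k < j} - {i})" by (simp add: card_mono)
  moreover have "card ({k. k < j} - {i}) + 1 = card {k. k < j}"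
    using assms(2) card_Suc_Diff1[of "{k. k < j}" i] by simp
  ultimately have "card (nbrs E i) + 1 \<le> card {k. k < j}" by linarith
  then show "deg_vec E $ i + 1 \<le> rk j"
    unfolding deg_vec_eq_card_nbrs[OF sg] rk_def by linarith
qed

text \<open>
  Subtracting the rank from the degree turns a shifted graph into its own system of threshold
  weights: \<open>{i, j}\<close> is an edge iff the weights of \<open>i\<close> and \<open>j\<close> have positive sum.
\<close>

definition shift_weight :: "('n::{finite,linorder}) set set \<Rightarrow> 'n \<Rightarrow> real" where
  "shift_weight E i = deg_vec E $ i - rk i"

text \<open>The two degree bounds add up to an excess of at least 1 for an edge and, in the next
  lemma, to a deficit of at least 1 for a non-edge.\<close>

lemma shift_weight_pos:
  fixes E :: "('n::{finite,linorder}) set set"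
  assumes "shifted E" "{i, j} \<in> E"
  shows "shift_weight E i + shift_weight E j > 0"
proof -
  have "i \<noteq> j" using assms simple_graphD[of E i j] by (simp add: shifted_def)
  then show ?thesis
    using shifted_edge_bounds[OF assms(1), of i j] shifted_edge_bounds[OF assms(1), of j i] assms(2)
    by (cases i j rule: linorder_cases) (auto simp: shift_weight_def insert_commute)
qed

lemma shift_weight_neg:
  fixes E :: "('n::{finite,linorder}) set set"
  assumes "shifted E" "{i, j} \<notin> E" "i \<noteq> j"
  shows "shift_weight E i + shift_weight E j < 0"
  using shifted_nonedge_bounds[OF assms(1), of i j] shifted_nonedge_bounds[OF assms(1), of j i] assms(2,3)
  by (cases i j rule: linorder_cases) (auto simp: shift_weight_def insert_commute)

subsection \<open>Degree partitions of threshold graphs as extreme points\<close>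

text \<open>Generators of \<open>DP\<close> in which the sorting is absorbed into the labelling of
  the vertices.\<close>

definition sorted_degree_vecs :: "(real ^ ('n::{finite,linorder})) set" where
  "sorted_degree_vecs = {deg_vec E | E. simple_graph UNIV E \<and> deg_vec E \<in> decreasing_vecs}"

lemma simple_graph_relabel:
  assumes "bij p" "simple_graph UNIV E"
  shows "simple_graph UNIV {e. p ` e \<in> E}"
proof -
  have "card e = 2" if "p ` e \<in> E" for e
  proof -
    have "card (p ` e) = 2" using assms that by (auto simp: simple_graph_def)
    then show ?thesis using assms(1) by (metis bij_is_inj card_image inj_on_subset subset_UNIV)
  qed
  then show ?thesis by (simp add: simple_graph_def)
qed

lemma vertex_degree_relabel:
  assumes "bij p"
  shows "vertex_degree {e. p ` e \<in> E} i = vertex_degree E (p i)"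
proof -
  have "bij_betw ((`) p) {e. p ` e \<in> E \<and> i \<in> e} {e \<in> E. p i \<in> e}"
    unfolding bij_betw_def
  proof
    show "inj_on ((`) p) {e. p ` e \<in> E \<and> i \<in> e}"
      using assms by (meson bij_is_inj inj_image_eq_iff inj_onI)
    show "(`) p ` {e. p ` e \<in> E \<and> i \<in> e} = {e \<in> E. p i \<in> e}"
    proof
      show "{e \<in> E. p i \<in> e} \<subseteq> (`) p ` {e. p ` e \<in> E \<and> i \<in> e}"
      proof
        fix e assume e: "e \<in> {e \<in> E. p i \<in> e}"
        have "p ` (p -` e) = e" using assms by (simp add: bij_is_surj surj_image_vimage_eq)
        then show "e \<in> (`) p ` {e. p ` e \<in> E \<and> i \<in> e}" using e
          by (intro image_eqI[of _ _ "p -` e"]) auto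
      qed
    qed auto
  qed
  then show ?thesis by (simp add: vertex_degree_def bij_betw_same_card)
qed

lemma is_degree_partition_deg_vec:
  "deg_vec E \<in> decreasing_vecs \<Longrightarrow> is_degree_partition E (deg_vec E)"
  unfolding is_degree_partition_def decreasing_vecs_def
  by (auto simp: deg_vec_def intro!: exI[of _ id])

lemma is_degree_partition_relabel:
  fixes d :: "real ^ ('n::{finite,linorder})"
  assumes "is_degree_partition E d"
  obtains p where "bij p" "d = deg_vec {e. p ` e \<in> E}" "d \<in> decreasing_vecs"
  using assms vertex_degree_relabel
  by (fastforce simp: is_degree_partition_def decreasing_vecs_def deg_vec_def vec_eq_iff)

lemma DP_eq: "DP = convex hull (sorted_degree_vecs :: (real ^ ('n::{finite,linorder})) set)"
proof -
  have "{d :: real ^ ('n::{finite,linorder}). \<exists>E. simple_graph UNIV E \<and> is_degree_partition E d} = sorted_degree_vecs"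
  proof
    show "sorted_degree_vecs \<subseteq> {d. \<exists>E. simple_graph UNIV E \<and> is_degree_partition E d}"
      using is_degree_partition_deg_vec by (fastforce simp: sorted_degree_vecs_def)
    show "{d. \<exists>E. simple_graph UNIV E \<and> is_degree_partition E d} \<subseteq> sorted_degree_vecs"
      using simple_graph_relabel
      by (fastforce simp: sorted_degree_vecs_def elim!: is_degree_partition_relabel)
  qed
  then show ?thesis by (simp add: DP_def)
qed

lemma finite_sorted_degree_vecs: "finite sorted_degree_vecs"
proof -
  have "sorted_degree_vecs \<subseteq> range deg_vec" by (auto simp: sorted_degree_vecs_def)
  then show ?thesis by (rule finite_subset) simp
qed

text \<open>If the four vertices were distinct, each would have both a neighbour and a non-neighbour
  among the others, so the subgraph induced on them would have neither a dominating nor an isolated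
  vertex.\<close>

lemma threshold_graph_no_alternating:
  assumes "threshold_graph UNIV E" "{i, y} \<in> E" "{j, x} \<in> E" "{i, x} \<notin> E" "{j, y} \<notin> E"
  shows "i = x \<or> j = y"
proof (rule ccontr)
  assume neq: "\<not> (i = x \<or> j = y)"
  have sg: "simple_graph UNIV E" using assms(1) by (simp add: threshold_graph_def)
  have ne: "i \<noteq> y" "j \<noteq> x" using simple_graphD[OF sg] assms by auto
  have "i \<noteq> j" "x \<noteq> y" using assms by auto
  note distinct = neq ne this
  define U where "U = {i, j, x, y}"
  obtain v where v: "dominating_vertex U (induced_edges E U) v
      \<or> isolated_vertex U (induced_edges E U) v"
    using assms(1) unfolding threshold_graph_def by (metis U_def empty_not_insert subset_UNIV)
  then have "v \<in> U" by (auto simp: dominating_vertex_def isolated_vertex_def)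
  then have "v = i \<or> v = j \<or> v = x \<or> v = y" by (simp add: U_def)
  with v distinct assms(2-5) show False
    by (auto simp: dominating_vertex_def isolated_vertex_def induced_edges_def U_def insert_commute)
qed

text \<open>Label the vertices by decreasing degree. If \<open>x\<close> is adjacent to
  \<open>j\<close> but not to the earlier vertex \<open>i\<close>, the absence of alternating
  4-cycles makes all other neighbours of \<open>i\<close> neighbours of \<open>j\<close>; with
  \<open>x\<close> in addition, \<open>j\<close> would have the larger degree.\<close>

lemma TP_imp_shifted:
  fixes d :: "real ^ ('n::{finite,linorder})"
  assumes "d \<in> TP"
  obtains D where "shifted D" "d = deg_vec D"
proof -
  obtain E where E: "threshold_graph UNIV E" "is_degree_partition E d"
    using assms by (auto simp: TP_def)
  obtain p where p: "bij p" "d = deg_vec {e. p ` e \<in> E}" "d \<in> decreasing_vecs"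
    using is_degree_partition_relabel[OF E(2)] by blast
  define D where "D = {e. p ` e \<in> E}"
  have sg: "simple_graph UNIV D"
    using simple_graph_relabel[OF p(1)] E(1) by (simp add: D_def threshold_graph_def)
  have "{i, x} \<in> D" if "i < j" "i \<noteq> x" "{j, x} \<in> D" for i j x
  proof (rule ccontr)
    assume nix: "{i, x} \<notin> D"
    have "nbrs D i - {j} \<subseteq> nbrs D j - {i}"
    proof
      fix y assume y: "y \<in> nbrs D i - {j}"
      have "y \<noteq> i" using y simple_graphD[OF sg, of y i] by (auto simp: nbrs_def)
      moreover have "{j, y} \<in> D"
      proof (rule ccontr)
        assume "{j, y} \<notin> D"
        then have "p i = p x \<or> p j = p y"
          using threshold_graph_no_alternating[OF E(1), of "p i" "p y" "p j" "p x"] y that nix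
          by (simp add: D_def nbrs_def insert_commute)
        then show False using p(1) that y by (auto simp: bij_def inj_eq)
      qed
      ultimately show "y \<in> nbrs D j - {i}" by (simp add: nbrs_def insert_commute)
    qed
    moreover have "x \<in> (nbrs D j - {i}) - (nbrs D i - {j})"
      using that nix by (auto simp: nbrs_def insert_commute)
    ultimately have "card (nbrs D i - {j}) < card (nbrs D j - {i})"
      by (metis DiffE finite psubsetI psubset_card_mono)
    \<comment> \<open>An edge between \<open>i\<close> and \<open>j\<close> counts once in each
      degree, so the strict inequality survives putting it back.\<close>
    moreover have "i \<in> nbrs D j \<longleftrightarrow> j \<in> nbrs D i" by (simp add: nbrs_def insert_commute)
    ultimately have "card (nbrs D i) < card (nbrs D j)"
      by (auto simp: card_Diff_singleton_if split: if_splits)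
    moreover have "d $ j \<le> d $ i" using p(3) that by (simp add: decreasing_vecs_def)
    ultimately show False using p(2) deg_vec_eq_card_nbrs[OF sg] by (simp add: D_def[symmetric])
  qed
  then have "shifted D" using sg by (auto simp: shifted_def)
  with that p(2) show thesis by (simp add: D_def)
qed

lemma shifted_mem_sorted_degree_vecs:
  "shifted D \<Longrightarrow> deg_vec D \<in> sorted_degree_vecs"
  using shifted_deg_vec_mem_decreasing by (auto simp: sorted_degree_vecs_def shifted_def)

text \<open>A supporting hyperplane cuts out a face, and a face of the hull of a finite set is
  spanned by generators. Hence only the values of \<open>c\<close> on the generators have to be
  studied.\<close>

lemma exposed_face_DP:
  fixes c :: "real ^ ('n::{finite,linorder})"
  assumes "\<And>x. x \<in> sorted_degree_vecs \<Longrightarrow> c \<bullet> x \<le> M"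
  obtains S where "S = {x \<in> sorted_degree_vecs. c \<bullet> x = M}" "(convex hull S) face_of DP"
proof -
  define T where "T = DP \<inter> {x. c \<bullet> x = M}"
  have "convex hull sorted_degree_vecs \<subseteq> {x. c \<bullet> x \<le> M}"
    using assms by (intro hull_minimal) (auto simp: convex_halfspace_le)
  then have T: "T face_of DP"
    unfolding T_def by (intro face_of_Int_supporting_hyperplane_le) (auto simp: DP_eq)
  then obtain S' where S': "S' \<subseteq> sorted_degree_vecs" "T = convex hull S'"
    using face_of_convex_hull_subset[OF finite_imp_compact[OF finite_sorted_degree_vecs]]
    by (metis DP_eq)
  let ?S = "{x \<in> sorted_degree_vecs. c \<bullet> x = M}"
  have "S' \<subseteq> ?S" using S' hull_subset[of S' convex] by (auto simp: T_def)
  moreover have "?S \<subseteq> T" by (auto simp: T_def DP_eq hull_inc)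
  moreover have "convex T" using T face_of_imp_convex by blast
  ultimately have "T = convex hull ?S"
    by (metis S'(2) hull_minimal hull_mono subset_antisym)
  with T that show thesis by blast
qed

text \<open>With the shift weights, edges of \<open>D\<close> have positive and non-edges negative
  weight, so \<open>D\<close> is the only maximiser and the exposed face is a single point.\<close>

lemma shifted_extreme_point_DP:
  fixes D :: "('n::{finite,linorder}) set set"
  assumes "shifted D"
  shows "deg_vec D extreme_point_of DP"
proof -
  define c :: "real ^ ('n::{finite,linorder})" where "c = (\<chi> i. shift_weight D i)"
  have sg: "simple_graph UNIV D" using assms by (simp add: shifted_def)
  have pos: "(\<Sum>k\<in>e. c $ k) > 0" if e: "e \<in> D" for e
  proof -
    obtain i j where "e = {i, j}" "i \<noteq> j"
      by (rule simple_graph_edgeE[OF sg e])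
    then show ?thesis using shift_weight_pos[OF assms] e by (simp add: c_def)
  qed
  have neg: "(\<Sum>k\<in>e. c $ k) < 0" if G: "simple_graph UNIV G" and e: "e \<in> G - D" for e G
  proof -
    from e have "e \<in> G" by simp
    then obtain i j where "e = {i, j}" "i \<noteq> j"
      by (rule simple_graph_edgeE[OF G])
    then show ?thesis using shift_weight_neg[OF assms] e by (simp add: c_def)
  qed
  have le: "c \<bullet> x \<le> c \<bullet> deg_vec D" if "x \<in> sorted_degree_vecs" for x
  proof -
    from that obtain G where G: "x = deg_vec G" "simple_graph UNIV G"
      by (auto simp: sorted_degree_vecs_def)
    show ?thesis unfolding G inner_deg_vec
      using pos neg[OF G(2)] by (intro sum_le_sum_positive_part) (auto simp: less_imp_le)
  qed
  have eq: "x = deg_vec D" if "x \<in> sorted_degree_vecs" "c \<bullet> x = c \<bullet> deg_vec D" for x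
  proof -
    from that obtain G where G: "x = deg_vec G" "simple_graph UNIV G"
      by (auto simp: sorted_degree_vecs_def)
    have sums: "(\<Sum>e\<in>G. \<Sum>k\<in>e. c $ k) = (\<Sum>e\<in>D. \<Sum>k\<in>e. c $ k)"
      using that(2) unfolding G inner_deg_vec .
    have "(\<Sum>k\<in>e. c $ k) = 0" if "e \<in> (D - G) \<union> (G - D)" for e
      by (rule sum_le_sum_positive_part(2)[OF _ _ _ _ sums that])
        (auto intro: less_imp_le pos neg[OF G(2)])
    then have "D - G \<union> (G - D) = {}" using pos neg[OF G(2)] by fastforce
    then show ?thesis using G by auto
  qed
  obtain S where S: "S = {x \<in> sorted_degree_vecs. c \<bullet> x = c \<bullet> deg_vec D}"
      "(convex hull S) face_of DP"
    using exposed_face_DP[of c] le by blast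
  have "S = {deg_vec D}" using S(1) eq shifted_mem_sorted_degree_vecs[OF assms] by auto
  then show ?thesis using S(2) by (simp add: face_of_singleton)
qed

subsection \<open>Edges of the polytope\<close>

text \<open>
  The vector \<open>b\<close> is the projection of \<open>c\<close> to the cone of decreasing vectors. If \<open>x\<close> is constant on
  the level sets of \<open>b\<close>, then \<open>b - t x\<close> stays in the cone for small \<open>t > 0\<close>, which forces equality.
\<close>

lemma decreasing_averaging:
  fixes c :: "real ^ ('n::{finite,linorder})"
  obtains b where "b \<in> decreasing_vecs"
    "\<And>x. x \<in> decreasing_vecs \<Longrightarrow> c \<bullet> x \<le> b \<bullet> x"
    "\<And>x. x \<in> decreasing_vecs \<Longrightarrow> (\<And>i j. b $ i = b $ j \<Longrightarrow> x $ i = x $ j) \<Longrightarrow> c \<bullet> x = b \<bullet> x"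
proof -
  define K :: "(real ^ ('n::{finite,linorder})) set" where "K = decreasing_vecs"
  define b where "b = closest_point K c"
  have K_eq: "K = (\<Inter>i. \<Inter>j. if i \<le> j then {x. x $ j \<le> x $ i} else UNIV)"
    by (auto simp: K_def decreasing_vecs_def split: if_splits)
  have "closed {x :: real ^ ('n::{finite,linorder}). x $ j \<le> x $ i}" for i j
    by (intro closed_Collect_le continuous_intros)
  then have "closed K" unfolding K_eq by (intro closed_INT) auto
  have add: "x + y \<in> K" if "x \<in> K" "y \<in> K" for x y
    using that by (auto simp: K_def decreasing_vecs_def add_mono)
  have scale: "a *\<^sub>R x \<in> K" if "x \<in> K" "a \<ge> 0" for a x
    using that by (auto simp: K_def decreasing_vecs_def mult_left_mono)
  have "convex K" using add scale by (auto simp: convex_def)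
  have "0 \<in> K" by (simp add: K_def decreasing_vecs_def)
  then have "b \<in> K" unfolding b_def using \<open>closed K\<close> by (intro closest_point_in_set) auto
  have dot: "(c - b) \<bullet> (x - b) \<le> 0" if "x \<in> K" for x
    unfolding b_def using \<open>convex K\<close> \<open>closed K\<close> that by (rule closest_point_dot)
  \<comment> \<open>The obtuse angle inequality at \<open>0\<close> and at twice \<open>b\<close>
    gives both signs.\<close>
  have dot_b: "(c - b) \<bullet> b = 0"
    using dot[OF \<open>0 \<in> K\<close>] dot[OF scale[OF \<open>b \<in> K\<close>, of 2]] by (simp add: inner_diff_right scaleR_2 inner_add_right)
  have le: "(c - b) \<bullet> x \<le> 0" if "x \<in> K" for x
    using dot[OF that] dot_b by (simp add: inner_diff_right)
  show thesis
  proof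
    show "b \<in> decreasing_vecs" using \<open>b \<in> K\<close> by (simp add: K_def)
    show "c \<bullet> x \<le> b \<bullet> x" if "x \<in> decreasing_vecs" for x
      using le that by (simp add: K_def inner_diff_left)
    fix x assume x: "x \<in> decreasing_vecs" and const: "\<And>i j. b $ i = b $ j \<Longrightarrow> x $ i = x $ j"
    \<comment> \<open>Where \<open>b\<close> differs at \<open>i\<close> and \<open>j\<close>, the
      inequality is strict and survives a small perturbation; where it agrees, so does
      \<open>x\<close>.\<close>
    have "\<forall>\<^sub>F t in at_right 0. i \<le> j \<longrightarrow> b $ j - t * x $ j \<le> b $ i - t * x $ i" for i j
    proof (cases "i \<le> j \<and> b $ i \<noteq> b $ j")
      case True
      then have "b $ j - 0 * x $ j < b $ i - 0 * x $ i"
        using \<open>b \<in> K\<close> by (auto simp: K_def decreasing_vecs_def order_less_le)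
      moreover have "((\<lambda>t. (b $ i - t * x $ i) - (b $ j - t * x $ j)) \<longlongrightarrow>
          (b $ i - 0 * x $ i) - (b $ j - 0 * x $ j)) (at_right 0)"
        by (intro tendsto_intros)
      ultimately have "\<forall>\<^sub>F t in at_right 0. 0 < (b $ i - t * x $ i) - (b $ j - t * x $ j)"
        by (intro order_tendstoD(1)) auto
      then show ?thesis by eventually_elim simp
    next
      case False
      then show ?thesis using const[of i j] by auto
    qed
    then have "\<forall>\<^sub>F t in at_right 0. \<forall>i j. i \<le> j \<longrightarrow> b $ j - t * x $ j \<le> b $ i - t * x $ i"
      by (simp add: eventually_all_finite)
    moreover have "\<forall>\<^sub>F t in at_right (0::real). t > 0" by (simp add: eventually_at_right_less)
    ultimately have "\<forall>\<^sub>F t in at_right 0. t > 0 \<and> b - t *\<^sub>R x \<in> K"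
      by eventually_elim (simp add: K_def decreasing_vecs_def)
    then obtain t where t: "t > 0" "b - t *\<^sub>R x \<in> K"
      using eventually_happens'[of "at_right (0::real)"] by (auto simp: trivial_limit_at_right_real)
    then have "t * ((c - b) \<bullet> x) \<ge> 0"
      using dot[OF t(2)] by simp
    then have "(c - b) \<bullet> x \<ge> 0" using t(1) by (simp add: zero_le_mult_iff)
    with le[of x] x show "c \<bullet> x = b \<bullet> x" by (simp add: K_def inner_diff_left)
  qed
qed

lemma index_interval_level_set:
  fixes b :: "real ^ ('n::{finite,linorder})"
  assumes "b \<in> decreasing_vecs" "b $ k = v"
  shows "index_interval {i. b $ i = v}"
proof -
  let ?L = "{i. b $ i = v}"
  have mem: "Min ?L \<in> ?L" "Max ?L \<in> ?L" using assms(2) by (intro Min_in Max_in; auto)+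
  have "?L = {Min ?L..Max ?L}"
  proof
    show "{Min ?L..Max ?L} \<subseteq> ?L"
    proof
      fix i assume "i \<in> {Min ?L..Max ?L}"
      then have "b $ i \<le> b $ (Min ?L)" "b $ (Max ?L) \<le> b $ i"
        using assms(1) by (auto simp: decreasing_vecs_def)
      with mem show "i \<in> ?L" by simp
    qed
  qed auto
  moreover have "Min ?L \<le> Max ?L" using mem by (meson Max_ge finite)
  ultimately show ?thesis unfolding index_interval_def by blast
qed

text \<open>Both neighbourhoods arise from one common set by removing the vertex itself, and that
  set contains either both or neither of \<open>i\<close> and \<open>j\<close>.\<close>

lemma deg_vec_const_on_level_sets:
  fixes b :: "real ^ ('n::finite)"
  assumes sg: "simple_graph UNIV E"
    and E: "\<And>i j. i \<noteq> j \<Longrightarrow> {i, j} \<in> E \<longleftrightarrow> P (b $ i) (b $ j)"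
    and eq: "b $ i = b $ j"
  shows "deg_vec E $ i = deg_vec E $ j"
proof -
  have *: "nbrs E k = {u. P (b $ u) (b $ k)} - {k}" for k
    using E[of _ k] simple_graphD[OF sg, of _ k] by (auto simp: nbrs_def)
  show ?thesis
    unfolding deg_vec_eq_card_nbrs[OF sg] * using eq by (simp add: card_Diff_singleton_if)
qed

lemma adjacent_imp_Omega:
  fixes d e :: "real ^ ('n::{finite,linorder})"
  assumes "d \<in> sorted_degree_vecs" "e \<in> sorted_degree_vecs"
    and "closed_segment d e edge_of DP"
  shows "\<exists>x y. {d, e} = {x, y} \<and> x \<le> y \<and>
     ((\<exists>I. nontrivial_interval I \<and> y - x = Omega1 I) \<or>
     (\<exists>I J. disjoint_interval_pair I J \<and> y - x = Omega2 I J))"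
proof -
  have "d \<noteq> e" using assms(3) by (auto simp: edge_of_def)
  have face: "closed_segment d e face_of DP" using assms(3) by (simp add: edge_of_def)
  have "polyhedron (DP :: (real ^ ('n::{finite,linorder})) set)"
    unfolding DP_eq by (intro polytope_imp_polyhedron polytope_convex_hull finite_sorted_degree_vecs)
  with face have "closed_segment d e exposed_face_of DP"
    by (simp add: exposed_face_of_polyhedron)
  then obtain c \<beta> where c: "DP \<subseteq> {x. c \<bullet> x \<le> \<beta>}" "closed_segment d e = DP \<inter> {x. c \<bullet> x = \<beta>}"
    unfolding exposed_face_of_def by blast
  have cd: "c \<bullet> d = \<beta>" "c \<bullet> e = \<beta>" using c(2) ends_in_segment by blast+
  have S_DP: "x \<in> DP" if "x \<in> sorted_degree_vecs" for x
    using that by (simp add: DP_eq hull_inc)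
  \<comment> \<open>An extreme point of \<open>DP\<close> on the segment must be one of its ends, as
    both ends lie in \<open>DP\<close>.\<close>
  have extreme: "x \<in> {d, e}" if "x = deg_vec G" "shifted G" "c \<bullet> x = \<beta>" for x G
  proof -
    have "x extreme_point_of DP" using shifted_extreme_point_DP that by blast
    moreover have "x \<in> closed_segment d e"
      using c(2) that S_DP shifted_mem_sorted_degree_vecs by auto
    moreover have "d \<in> DP" "e \<in> DP" using S_DP assms by auto
    ultimately show ?thesis
      by (auto simp: extreme_point_of_def open_segment_def)
  qed
  obtain b where b: "b \<in> decreasing_vecs"
    "\<And>x. x \<in> decreasing_vecs \<Longrightarrow> c \<bullet> x \<le> b \<bullet> x"
    "\<And>x. x \<in> decreasing_vecs \<Longrightarrow> (\<And>i j. b $ i = b $ j \<Longrightarrow> x $ i = x $ j) \<Longrightarrow> c \<bullet> x = b \<bullet> x"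
    using decreasing_averaging[of c] by blast
  define s where "s e = (\<Sum>k\<in>e. b $ k)" for e
  \<comment> \<open>The parameter selects which pairs of weight 0 become edges. At \<open>-1\<close>
    none do, since absolute values are nonnegative.\<close>
  define G where "G v = {e. card e = 2 \<and> (s e > 0 \<or> s e = 0 \<and> (\<forall>k\<in>e. \<bar>b $ k\<bar> = v))}" for v
  have sgG: "simple_graph UNIV (G v)" for v by (simp add: G_def simple_graph_def)
  have edge_G: "{i, j} \<in> G v \<longleftrightarrow>
      b $ i + b $ j > 0 \<or> b $ i + b $ j = 0 \<and> \<bar>b $ i\<bar> = v \<and> \<bar>b $ j\<bar> = v" if "i \<noteq> j" for i j v
    using that by (simp add: G_def s_def)
  have shG: "shifted (G v)" for v
    unfolding shifted_def
  proof (intro conjI allI impI sgG)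
    fix i j k :: 'n assume *: "i < j \<and> i \<noteq> k \<and> {j, k} \<in> G v"
    have "j \<noteq> k" using * simple_graphD[OF sgG] by auto
    moreover have "b $ j \<le> b $ i" using b(1) * by (simp add: decreasing_vecs_def less_imp_le)
    ultimately show "{i, k} \<in> G v" using * edge_G[of i k] edge_G[of j k] by force
  qed
  have cG: "c \<bullet> deg_vec (G v) = b \<bullet> deg_vec (G v)" for v
  proof (rule b(3))
    show "deg_vec (G v) \<in> decreasing_vecs" using shG by (rule shifted_deg_vec_mem_decreasing)
    fix i j assume "b $ i = b $ j"
    then show "deg_vec (G v) $ i = deg_vec (G v) $ j"
      by (intro deg_vec_const_on_level_sets[OF sgG edge_G])
  qed
  have opt: "b \<bullet> deg_vec H \<le> b \<bullet> deg_vec (G v)" if "simple_graph UNIV H" for H v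
    unfolding inner_deg_vec
    by (rule sum_le_sum_positive_part)
      (use that in \<open>auto simp: G_def s_def[symmetric] simple_graph_def not_less\<close>)
  have G_le: "b \<bullet> deg_vec (G v) \<le> \<beta>" for v
    using c(1) S_DP[OF shifted_mem_sorted_degree_vecs[OF shG[of v]]] cG[of v] by auto
  \<comment> \<open>The chain is: value of \<open>c\<close> on \<open>H\<close>, value of
    \<open>b\<close> on \<open>H\<close>, value of \<open>b\<close> on \<open>G v\<close>, and back
    to \<beta>. Each is at most the next, so all are equal.\<close>
  have max: "b \<bullet> deg_vec H = b \<bullet> deg_vec (G v)" "b \<bullet> deg_vec (G v) = \<beta>"
    if "simple_graph UNIV H" "deg_vec H \<in> decreasing_vecs" "c \<bullet> deg_vec H = \<beta>" for H v
    using opt[OF that(1), of v] b(2)[OF that(2)] that(3) G_le[of v] by linarith+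
  obtain D where D: "d = deg_vec D" "simple_graph UNIV D" "d \<in> decreasing_vecs"
    using assms(1) by (auto simp: sorted_degree_vecs_def)
  obtain E where E: "e = deg_vec E" "simple_graph UNIV E" "e \<in> decreasing_vecs"
    using assms(2) by (auto simp: sorted_degree_vecs_def)
  have G_in: "deg_vec (G v) \<in> {d, e}" for v
    using extreme[OF refl shG] max(2)[OF D(2)] D cd cG by metis
  \<comment> \<open>An optimal graph differs from \<open>G (-1)\<close> only in pairs of weight 0.
    Without such pairs \<open>D\<close> and \<open>E\<close> would both be
    \<open>G (-1)\<close>.\<close>
  obtain g where g: "card g = 2" "s g = 0"
  proof -
    have *: "\<exists>g. card g = 2 \<and> s g = 0" if H: "simple_graph UNIV H" "H \<noteq> G (-1)"
      "b \<bullet> deg_vec H = b \<bullet> deg_vec (G (-1))" for H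
    proof -
      obtain g where g: "g \<in> (G (-1) - H) \<union> (H - G (-1))" using H(2) by blast
      have "(\<Sum>k\<in>g. b $ k) = 0"
        by (rule sum_le_sum_positive_part(2)[OF _ _ _ _ _ g])
          (use H in \<open>auto simp: inner_deg_vec G_def s_def[symmetric] simple_graph_def not_less\<close>)
      moreover have "card g = 2" using g sgG H(1) by (auto simp: simple_graph_def)
      ultimately show ?thesis by (auto simp: s_def)
    qed
    have "D \<noteq> G (-1) \<or> E \<noteq> G (-1)" using \<open>d \<noteq> e\<close> D E by auto
    then show thesis using *[OF D(2)] *[OF E(2)] max(1)[OF D(2)] max(1)[OF E(2)] D E cd that by metis
  qed
  obtain i j where ij: "i < j" "b $ i + b $ j = 0"
  proof -
    obtain i j where "g = {i, j}" "i \<noteq> j" using g(1) by (meson card_2_iff)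
    then show thesis using that[of i j] that[of j i] g(2) by (auto simp: s_def neq_iff add.commute)
  qed
  define v where "v = b $ i"
  have v: "b $ i = v" "b $ j = - v" using ij by (auto simp: v_def)
  have "b $ j \<le> b $ i" using b(1) ij by (simp add: decreasing_vecs_def)
  then have v0: "v \<ge> 0" using v by simp
  define Z where "Z = {e. card e = 2 \<and> s e = 0 \<and> (\<forall>k\<in>e. \<bar>b $ k\<bar> = v)}"
  have sgZ: "simple_graph UNIV Z" by (simp add: Z_def simple_graph_def)
  have "G v = G (-1) \<union> Z" "G (-1) \<inter> Z = {}" by (auto simp: G_def Z_def card_2_iff)
  then have GZ: "deg_vec (G v) = deg_vec (G (-1)) + deg_vec Z" by (simp add: deg_vec_Un)
  have edge_Z: "{k, u} \<in> Z \<longleftrightarrow> k \<noteq> u \<and> b $ k = - b $ u \<and> \<bar>b $ u\<bar> = v" for k u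
    by (cases "k = u") (auto simp: Z_def s_def)
  have nbrs_Z: "nbrs Z u = (if b $ u = v then {k. b $ k = - v} - {u} else if b $ u = - v
      then {k. b $ k = v} - {u} else {})" for u
    using v0 by (auto simp: nbrs_def edge_Z)
  \<comment> \<open>As \<open>Z\<close> joins \<open>i\<close> and \<open>j\<close>, the graphs
    \<open>G (-1)\<close> and \<open>G v\<close> have different degree vectors, which must then be
    the two ends of the segment.\<close>
  have "j \<in> nbrs Z i" using v ij by (simp add: nbrs_Z)
  then have "deg_vec Z $ i > 0" by (auto simp: deg_vec_eq_card_nbrs[OF sgZ] card_gt_0_iff)
  then have "deg_vec (G v) \<noteq> deg_vec (G (-1))" using GZ by auto
  then have eq: "{d, e} = {deg_vec (G (-1)), deg_vec (G v)}"
    using G_in[of v] G_in[of "-1"] by auto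
  have le: "deg_vec (G (-1)) \<le> deg_vec (G v)"
    unfolding GZ less_eq_vec_def by (simp add: deg_vec_def)
  let ?I = "{k. b $ k = v}" and ?J = "{k. b $ k = - v}"
  have int: "index_interval ?I" "index_interval ?J"
    using index_interval_level_set[OF b(1) v(1)] index_interval_level_set[OF b(1) v(2)] by auto
  \<comment> \<open>At \<open>v = 0\<close> the two level sets coincide and \<open>Z\<close> is
    complete on them; otherwise \<open>Z\<close> is complete bipartite between them.\<close>
  have "(\<exists>I. nontrivial_interval I \<and> deg_vec Z = Omega1 I) \<or>
     (\<exists>I J. disjoint_interval_pair I J \<and> deg_vec Z = Omega2 I J)"
  proof (cases "v = 0")
    case True
    have "card {i, j} \<le> card ?I" using v True by (intro card_mono) auto
    then have "nontrivial_interval ?I" using int ij by (simp add: nontrivial_interval_def)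
    moreover have "deg_vec Z = Omega1 ?I"
      using True by (auto simp: vec_eq_iff Omega1_def deg_vec_eq_card_nbrs[OF sgZ] nbrs_Z
          card_Diff_singleton_if of_nat_diff Suc_le_eq card_gt_0_iff)
    ultimately show ?thesis by blast
  next
    case False
    have "Max ?I < Min ?J"
    proof -
      have "Max ?I \<in> ?I" "Min ?J \<in> ?J" using v by (intro Min_in Max_in; auto)+
      then have "\<not> b $ (Max ?I) \<le> b $ (Min ?J)" using v0 False by auto
      then show ?thesis using b(1) by (auto simp: decreasing_vecs_def not_le[symmetric])
    qed
    then have "disjoint_interval_pair ?I ?J" using int by (simp add: disjoint_interval_pair_def)
    moreover have "deg_vec Z = Omega2 ?I ?J"
      using False by (auto simp: vec_eq_iff Omega2_def deg_vec_eq_card_nbrs[OF sgZ] nbrs_Z)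
    ultimately show ?thesis by blast
  qed
  moreover have "deg_vec (G v) - deg_vec (G (-1)) = deg_vec Z" by (simp add: GZ)
  ultimately show ?thesis using eq le by metis
qed

subsection \<open>Adding complete and complete bipartite blocks\<close>

text \<open>An edge of \<open>D\<close> missing in \<open>E\<close> would force its larger endpoint
  to have degree at least \<open>rk i + 1\<close> in \<open>D\<close> but at most
  \<open>rk i\<close> in \<open>E\<close>.\<close>

lemma shifted_deg_vec_le_imp_subset:
  fixes D E :: "('n::{finite,linorder}) set set"
  assumes "shifted D" "shifted E" "deg_vec D \<le> deg_vec E"
  shows "D \<subseteq> E"
proof
  fix e assume e: "e \<in> D"
  obtain i j where ij: "e = {i, j}" "i < j"
  proof -
    have "simple_graph UNIV D" using assms(1) by (simp add: shifted_def)
    then obtain i j where "e = {i, j}" "i \<noteq> j" using e by (rule simple_graph_edgeE)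
    then show thesis using that[of i j] that[of j i] by (auto simp: neq_iff insert_commute)
  qed
  show "e \<in> E"
  proof (rule ccontr)
    assume "e \<notin> E"
    then have "deg_vec E $ j < deg_vec D $ j"
      using shifted_edge_bounds(1)[OF assms(1) ij(2)] shifted_nonedge_bounds(1)[OF assms(2) ij(2)] e ij(1)
      by force
    then show False using assms(3) by (auto simp: less_eq_vec_def not_le[symmetric])
  qed
qed

section \<open>Recovering the added edges from their degree vector\<close>

lemma nbrs_eq_of_card:
  assumes "nbrs F x \<subseteq> (A :: ('n::finite) set)" "simple_graph UNIV F" "deg_vec F $ x = real (card A)"
  shows "nbrs F x = A"
  using assms by (intro card_subset_eq) (auto simp: deg_vec_eq_card_nbrs)

lemma deg_vec_pos:
  fixes F :: "('n::finite) set set"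
  assumes "simple_graph UNIV F" "{x, y} \<in> F"
  shows "deg_vec F $ x > 0" "deg_vec F $ y > 0"
  using assms by (auto simp: deg_vec_eq_card_nbrs card_gt_0_iff nbrs_def insert_commute)

text \<open>Only vertices of \<open>I\<close> have edges at all, and the degree of each is the
  largest possible inside \<open>I\<close>.\<close>

lemma edges_of_Omega1:
  fixes F :: "('n::{finite,linorder}) set set"
  assumes sg: "simple_graph UNIV F" and F: "deg_vec F = Omega1 I"
  shows "{x, y} \<in> F \<longleftrightarrow> x \<noteq> y \<and> x \<in> I \<and> y \<in> I"
proof -
  have supp: "x \<in> I \<and> y \<in> I" if "{x, y} \<in> F" for x y
    using deg_vec_pos[OF sg that] by (auto simp: F Omega1_def split: if_splits)
  have "nbrs F x = I - {x}" if "x \<in> I" for x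
  proof (rule nbrs_eq_of_card[OF _ sg])
    show "nbrs F x \<subseteq> I - {x}" using supp simple_graphD[OF sg] by (auto simp: nbrs_def)
    have "card (I - {x}) = card I - 1" "card I > 0" using that by (auto simp: card_gt_0_iff)
    then show "deg_vec F $ x = real (card (I - {x}))" using that by (simp add: F Omega1_def)
  qed
  then show ?thesis using supp by (auto simp: nbrs_def)
qed

text \<open>The degrees alone need not determine the edges; shiftedness of \<open>D\<close> and
  \<open>E\<close> excludes edges inside a block. Then each vertex has exactly enough neighbours to
  be joined to the whole other block.\<close>

lemma edges_of_Omega2:
  fixes D E :: "('n::{finite,linorder}) set set"
  assumes D: "shifted D" and E: "shifted E" and F: "deg_vec (E - D) = Omega2 I J"
    and less: "\<And>i j. i \<in> I \<Longrightarrow> j \<in> J \<Longrightarrow> i < j"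
  shows "{x, y} \<in> E - D \<longleftrightarrow> (x \<in> I \<and> y \<in> J) \<or> (x \<in> J \<and> y \<in> I)"
proof -
  let ?F = "E - D"
  have sg: "simple_graph UNIV ?F" using E by (auto simp: shifted_def intro: simple_graph_subset)
  note neq = simple_graphD[OF sg]
  have supp: "x \<in> I \<union> J \<and> y \<in> I \<union> J" if "{x, y} \<in> ?F" for x y
    using deg_vec_pos[OF sg that] by (auto simp: F Omega2_def split: if_splits)
  have dI: "card (nbrs ?F x) = card J" if "x \<in> I" for x
    using that F deg_vec_eq_card_nbrs[OF sg, of x] by (simp add: Omega2_def)
  have dJ: "card (nbrs ?F x) = card I" if "x \<in> J" for x
  proof -
    have "x \<notin> I" using less[of x x] that by blast
    then show ?thesis using that F deg_vec_eq_card_nbrs[OF sg, of x] by (simp add: Omega2_def)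
  qed
  \<comment> \<open>As \<open>a\<close> uses up one neighbour of \<open>b\<close>, some
    \<open>y\<close> in \<open>J\<close> is not joined to \<open>b\<close>, not even in
    \<open>E\<close>. By shiftedness all new neighbours of \<open>y\<close> precede
    \<open>b\<close>, so they are too few.\<close>
  have noI: False if "a \<in> I" "b \<in> I" "a < b" "{a, b} \<in> ?F" for a b
  proof -
    have "\<not> J \<subseteq> nbrs ?F b"
    proof
      assume "J \<subseteq> nbrs ?F b"
      then have "nbrs ?F b = J" using dI[OF that(2)] by (metis card_subset_eq finite)
      moreover have "a \<in> nbrs ?F b" using that by (simp add: nbrs_def)
      ultimately show False using less[OF that(1), of a] by auto
    qed
    then obtain y where y: "y \<in> J" "{y, b} \<notin> ?F" by (auto simp: nbrs_def)
    have "{y, b} \<notin> D"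
      using shiftedD[OF D _ less_imp_le[OF less[OF that(1) y(1)]], of b] that by auto
    then have yb: "{b, y} \<notin> E" using y by (auto simp: insert_commute)
    have "nbrs ?F y \<subseteq> I - {b}"
    proof
      fix x assume x: "x \<in> nbrs ?F y"
      then have xy: "{x, y} \<in> E" "x \<noteq> y" "x \<in> I \<union> J"
        using neq[of x y] supp[of x y] by (auto simp: nbrs_def)
      have "\<not> b \<le> x" using shiftedD[OF E xy(1), of b] yb less[OF that(2) y(1)] by auto
      then show "x \<in> I - {b}" using xy less[OF that(2)] by force
    qed
    then have "card I \<le> card (I - {b})" using dJ[OF y(1)] by (metis card_mono finite)
    then show False using that(2) by (metis card_Diff1_less finite not_le)
  qed
  \<comment> \<open>The mirror argument: some \<open>x\<close> in \<open>I\<close> is joined to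
    \<open>a\<close> already in \<open>D\<close>, so all new neighbours of \<open>x\<close> come
    after \<open>a\<close>, and again they are too few.\<close>
  have noJ: False if "a \<in> J" "b \<in> J" "a < b" "{a, b} \<in> ?F" for a b
  proof -
    have "\<not> I \<subseteq> nbrs ?F a"
    proof
      assume "I \<subseteq> nbrs ?F a"
      then have "nbrs ?F a = I" using dJ[OF that(1)] by (metis card_subset_eq finite)
      moreover have "b \<in> nbrs ?F a" using that by (simp add: nbrs_def insert_commute)
      ultimately show False using less[of b b] that by auto
    qed
    then obtain x where x: "x \<in> I" "{x, a} \<notin> ?F" by (auto simp: nbrs_def)
    have "{x, a} \<in> E"
      using shiftedD[OF E, of b a x] less[OF x(1)] that by (force simp: insert_commute)
    then have xa: "{a, x} \<in> D" using x by (auto simp: insert_commute)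
    have "nbrs ?F x \<subseteq> J - {a}"
    proof
      fix y assume y: "y \<in> nbrs ?F x"
      then have yx: "{y, x} \<notin> D" "y \<noteq> x" "y \<in> I \<union> J"
        using neq[of y x] supp[of y x] by (auto simp: nbrs_def)
      have "\<not> y \<le> a" using shiftedD[OF D xa, of y] yx by auto
      then show "y \<in> J - {a}" using yx less[OF _ that(1)] by force
    qed
    then have "card J \<le> card (J - {a})" using dI[OF x(1)] by (metis card_mono finite)
    then show False using that(1) by (metis card_Diff1_less finite not_le)
  qed
  have "nbrs ?F x = J" if "x \<in> I" for x
  proof (rule card_subset_eq)
    show "nbrs ?F x \<subseteq> J"
    proof
      fix y assume "y \<in> nbrs ?F x"
      then have y: "{y, x} \<in> ?F" by (simp add: nbrs_def)
      then show "y \<in> J"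
        using supp[OF y] neq[OF y] noI[of x y] noI[of y x] that by (auto simp: neq_iff insert_commute)
    qed
  qed (use dI[OF that] in auto)
  moreover have "nbrs ?F x = I" if "x \<in> J" for x
  proof (rule card_subset_eq)
    show "nbrs ?F x \<subseteq> I"
    proof
      fix y assume "y \<in> nbrs ?F x"
      then have y: "{y, x} \<in> ?F" by (simp add: nbrs_def)
      then show "y \<in> I"
        using supp[OF y] neq[OF y] noJ[of x y] noJ[of y x] that by (auto simp: neq_iff insert_commute)
    qed
  qed (use dJ[OF that] in auto)
  ultimately show ?thesis using supp[of x y] by (auto simp: nbrs_def)
qed

text \<open>
  Both shapes of a step are treated together: \<open>I = J\<close> nontrivial (the step adds the complete graph
  on \<open>I\<close>), or \<open>I\<close> entirely before \<open>J\<close> (it adds the complete bipartite graph between them).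
\<close>

locale block_step =
  fixes D E :: "('n::{finite,linorder}) set set" and I J and a b a' b' :: 'n
  assumes D: "shifted D" and E: "shifted E" and DE: "D \<subseteq> E"
    and I: "I = {a..b}" "a \<le> b" and J: "J = {a'..b'}" "a' \<le> b'"
    and edges: "{x, y} \<in> E - D \<longleftrightarrow> x \<noteq> y \<and> ((x \<in> I \<and> y \<in> J) \<or> (x \<in> J \<and> y \<in> I))"
    and blocks: "(a = a' \<and> b = b' \<and> a < b) \<or> b < a'"
begin

lemma ends_mem: "a \<in> I" "b \<in> I" "a' \<in> J" "b' \<in> J"
  using I J by auto

lemma sg: "simple_graph UNIV D" "simple_graph UNIV E" "simple_graph UNIV (E - D)"
  using D E by (auto simp: shifted_def intro: simple_graph_subset)

lemma block_cases:
  obtains (same) "I = J" "a' = a" "b' = b" "a < b" | (disjoint) "b < a'" "I \<inter> J = {}"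
  using blocks I J by force

section \<open>Blocks as classes of interchangeable vertices\<close>

definition equiv :: "'n \<Rightarrow> 'n \<Rightarrow> bool" where
  "equiv x x' \<longleftrightarrow> x = x' \<or> (x \<in> I \<and> x' \<in> I) \<or> (x \<in> J \<and> x' \<in> J)"

lemma equiv_sym: "equiv x x' \<Longrightarrow> equiv x' x"
  by (auto simp: equiv_def)

text \<open>Moving to a smaller vertex is shiftedness. Otherwise \<open>y\<close> lies outside both
  blocks, and an added edge at \<open>x'\<close> shows by shiftedness that \<open>y\<close> is
  joined to \<open>x'\<close> in \<open>E\<close>; since no added edge meets \<open>y\<close>, the
  edge is already in \<open>D\<close>.\<close>

lemma replace_endpoint:
  assumes xy: "{x, y} \<in> D" and eq: "equiv x x'" and y: "\<not> equiv x y"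
  shows "{x', y} \<in> D"
proof (cases "x' \<le> x")
  case True
  have "x' \<noteq> y" using eq y by auto
  then show ?thesis using shiftedD[OF D xy True] by simp
next
  case False
  then have x: "x \<in> I \<and> x' \<in> I \<or> x \<in> J \<and> x' \<in> J" and less: "x < x'" using eq by (auto simp: equiv_def)
  have y': "y \<notin> I" "y \<notin> J" using x y xy edges[of x y] by (auto simp: equiv_def)
  show ?thesis
  proof (cases rule: block_cases)
    case same
    then have "{x, x'} \<in> E - D" using edges[of x x'] x less by auto
    then have xx: "{x', x} \<notin> D" "{x', x} \<in> E" by (auto simp: insert_commute)
    have "\<not> x' \<le> y"
      using shiftedD[OF D, of y x x'] xy xx(1) less by (auto simp: insert_commute)
    then have "y \<le> x" using y' x I J same by force
    then have "{y, x'} \<in> E" using shiftedD[OF E, of x x' y] xx(2) less by (auto simp: insert_commute)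
    then show ?thesis using edges[of y x'] y' by (auto simp: insert_commute)
  next
    case disjoint
    obtain j where j: "(x \<in> I \<and> x' \<in> I \<and> j \<in> J) \<or> (x \<in> J \<and> x' \<in> J \<and> j \<in> I)"
      using x I J by fastforce
    then have "j \<noteq> x" "j \<noteq> x'" using disjoint by auto
    then have F: "{j, x} \<in> E - D" "{j, x'} \<in> E - D" using edges[of j x] edges[of j x'] j by auto
    have "\<not> j \<le> y"
      using shiftedD[OF D, of y x j] xy F(1) \<open>j \<noteq> x\<close> by (auto simp: insert_commute)
    moreover have "y \<noteq> x'" using x y' by blast
    ultimately have "{y, x'} \<in> E" using shiftedD[OF E, of j x' y] F(2) by simp
    then show ?thesis using edges[of y x'] y' by (auto simp: insert_commute)
  qed
qed

text \<open>Shifting an endpoint of an added edge from \<open>J\<close> down into \<open>I\<close>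
  gives an edge of \<open>E\<close> inside \<open>I\<close>, which cannot be an added one.\<close>

lemma same_block_D:
  assumes "b < a'" "x \<in> I" "y \<in> I" "x \<noteq> y"
  shows "{x, y} \<in> D"
proof -
  have "y < a'" "x < a'" using assms I by auto
  have "a' \<in> J" using J by auto
  then have "{a', y} \<in> E" using edges[of a' y] assms \<open>y < a'\<close> by auto
  then have "{x, y} \<in> E" using shiftedD[OF E, of a' y x] assms \<open>x < a'\<close> by auto
  moreover have "x \<notin> J" "y \<notin> J" using assms I J by auto
  ultimately show ?thesis using edges[of x y] by auto
qed

text \<open>Such an edge would lie in \<open>D\<close>; shifting one endpoint down to
  \<open>b\<close> would put a pair of \<open>E - D\<close> into \<open>D\<close>.\<close>

lemma same_block_E:
  assumes "b < a'" "x \<in> J" "y \<in> J"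
  shows "{x, y} \<notin> E"
proof
  assume xy: "{x, y} \<in> E"
  have "b \<in> I" "b < x" "b < y" using I J assms by auto
  have "x \<notin> I" "y \<notin> I" using assms I J by auto
  then have "{x, y} \<in> D" using edges[of x y] xy by auto
  then have "{b, y} \<in> D" using shiftedD[OF D, of x y b] \<open>b < x\<close> \<open>b < y\<close> by auto
  then show False using edges[of b y] \<open>b \<in> I\<close> assms \<open>b < y\<close> by auto
qed

text \<open>Inequivalent endpoints are replaced one at a time. Equivalent ones can only lie in
  \<open>I\<close> with the blocks disjoint, where \<open>D\<close> is complete.\<close>

lemma replace_D:
  assumes "equiv x x'" "equiv y y'" "x' \<noteq> y'" "{x, y} \<in> D"
  shows "{x', y'} \<in> D"
proof (cases "equiv x y")
  case True
  have "x \<noteq> y" using simple_graphD[OF sg(1)] assms by auto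
  with True have xy: "x \<in> I \<and> y \<in> I \<or> x \<in> J \<and> y \<in> J" by (auto simp: equiv_def)
  show ?thesis
  proof (cases rule: block_cases)
    case same
    then have "{x, y} \<in> E - D" using edges[of x y] xy \<open>x \<noteq> y\<close> by auto
    then show ?thesis using assms by simp
  next
    case disjoint
    have "\<not> (x \<in> J \<and> y \<in> J)" using same_block_E[OF disjoint(1)] assms DE by blast
    then have "x' \<in> I" "y' \<in> I" using xy assms disjoint by (auto simp: equiv_def)
    then show ?thesis using same_block_D[OF disjoint(1)] assms by blast
  qed
next
  case False
  have "{y, x'} \<in> D" using replace_endpoint[OF assms(4,1) False] by (simp add: insert_commute)
  moreover have "\<not> equiv y x'"
    using False assms(1) block_cases unfolding equiv_def by (metis disjoint_iff)
  ultimately have "{y', x'} \<in> D" using replace_endpoint[OF _ assms(2)] by blast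
  then show ?thesis by (simp add: insert_commute)
qed

lemma replace_E:
  assumes "equiv x x'" "equiv y y'" "x' \<noteq> y'" "{x, y} \<in> E"
  shows "{x', y'} \<in> E"
proof (cases "{x, y} \<in> D")
  case True
  then show ?thesis using replace_D[OF assms(1-3)] DE by blast
next
  case False
  then have "(x \<in> I \<and> y \<in> J) \<or> (x \<in> J \<and> y \<in> I)" using edges[of x y] assms(4) by auto
  then have "(x' \<in> I \<and> y' \<in> J) \<or> (x' \<in> J \<and> y' \<in> I)"
    using assms(1,2) unfolding equiv_def by (cases rule: block_cases) auto
  then show ?thesis using edges[of x' y'] assms(3) by auto
qed

section \<open>Degrees on the blocks\<close>

lemma nbrs_diff: "nbrs (E - D) x = (if x \<in> I then J - {x} else if x \<in> J then I - {x} else {})"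
  using edges[of _ x] by (cases rule: block_cases) (auto simp: nbrs_def)

lemma deg_E: "deg_vec E = deg_vec D + deg_vec (E - D)"
  using deg_vec_Un[of D "E - D"] DE by (simp add: Un_absorb1)

text \<open>Shiftedness bounds the degrees in \<open>D\<close> from above and those in
  \<open>E\<close> from below; the known degrees in \<open>E - D\<close> equal the gap, so all
  bounds are attained. The last identity makes the weights of added edges vanish.\<close>

lemma deg_D_ends: "deg_vec D $ a = deg_vec D $ b" "deg_vec D $ a' = deg_vec D $ b'"
  "deg_vec D $ a + deg_vec D $ a' + deg_vec D $ b + deg_vec D $ b'
     + deg_vec E $ a + deg_vec E $ a' + deg_vec E $ b + deg_vec E $ b'
     = 2 * (rk a + rk a' + rk b + rk b')"
proof -
  have "deg_vec D $ a = deg_vec D $ b \<and> deg_vec D $ a' = deg_vec D $ b' \<and>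
    deg_vec D $ a + deg_vec D $ a' + deg_vec D $ b + deg_vec D $ b'
     + deg_vec E $ a + deg_vec E $ a' + deg_vec E $ b + deg_vec E $ b'
     = 2 * (rk a + rk a' + rk b + rk b')"
  proof (cases rule: block_cases)
    case same
    have ab: "a \<in> I" "b \<in> I" using I by auto
    have dF: "deg_vec (E - D) $ x = rk b - rk a" if "x \<in> I" for x
    proof -
      have "card (J - {x}) = card J - 1" "card J > 0"
        using that same by (auto simp: card_gt_0_iff)
      then show ?thesis
        using that card_interval_rk[OF I(2)] same I by (simp add: deg_vec_eq_card_nbrs[OF sg(3)] nbrs_diff)
    qed
    have F: "{a, b} \<in> E - D" using edges[of a b] same ab by auto
    have "nbrs D a \<subseteq> {k. k < a}"
    proof
      fix k assume "k \<in> nbrs D a"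
      then have k: "{k, a} \<in> D" by (simp add: nbrs_def)
      then have "k \<noteq> a" "k \<notin> I" using simple_graphD[OF sg(1) k] edges[of k a] ab same by auto
      moreover have "\<not> b \<le> k" using shiftedD[OF D k, of b] F same by (auto simp: insert_commute)
      ultimately show "k \<in> {k. k < a}" using I by auto
    qed
    then have "card (nbrs D a) \<le> card {k. k < a}" by (simp add: card_mono)
    then have 1: "deg_vec D $ a \<le> rk a" by (simp add: deg_vec_eq_card_nbrs[OF sg(1)] rk_def)
    have "{k. k < b} \<subseteq> nbrs E b"
    proof
      fix k assume k: "k \<in> {k. k < b}"
      show "k \<in> nbrs E b"
      proof (cases "k \<le> a")
        case True
        then show ?thesis using shiftedD[OF E, of a b k] F k by (simp add: nbrs_def)
      next
        case False
        then have "k \<in> I" "k \<noteq> b" using k I(1) by auto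
        then have "{k, b} \<in> E - D" using edges[of k b] ab same(1) by blast
        then show ?thesis by (simp add: nbrs_def)
      qed
    qed
    then have "card {k. k < b} \<le> card (nbrs E b)" by (simp add: card_mono)
    then have 2: "rk b \<le> deg_vec E $ b" by (simp add: deg_vec_eq_card_nbrs[OF sg(2)] rk_def)
    have "deg_vec D $ b \<le> deg_vec D $ a"
      using shifted_deg_vec_mem_decreasing[OF D] I by (simp add: decreasing_vecs_def)
    then show ?thesis using 1 2 dF[OF ab(1)] dF[OF ab(2)] same by (simp add: deg_E)
  next
    case disjoint
    have "deg_vec D $ x = rk a' - 1 \<and> deg_vec (E - D) $ x = rk b' - rk a' + 1" if x: "x \<in> I" for x
    proof -
      have "x < a'" "x < b'" "a' \<in> J" "b' \<in> J" using x disjoint I J by auto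
      then have F: "{x, a'} \<in> E - D" "{x, b'} \<in> E - D" using edges[of x a'] edges[of x b'] x by auto
      have "deg_vec D $ x + 1 \<le> rk a'"
        using shifted_nonedge_bounds(2)[OF D \<open>x < a'\<close>] F by simp
      moreover have "rk b' \<le> deg_vec E $ x"
        using shifted_edge_bounds(2)[OF E \<open>x < b'\<close>] F by simp
      moreover have "deg_vec (E - D) $ x = rk b' - rk a' + 1"
      proof -
        have "J - {x} = J" using x disjoint by auto
        then have "nbrs (E - D) x = J" using x nbrs_diff[of x] by simp
        then show ?thesis
          using card_interval_rk[OF J(2)] J(1) by (simp add: deg_vec_eq_card_nbrs[OF sg(3)])
      qed
      ultimately show ?thesis by (simp add: deg_E)
    qed
    from this[of a] this[of b]
    have i: "deg_vec D $ a = rk a' - 1" "deg_vec (E - D) $ a = rk b' - rk a' + 1"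
        "deg_vec D $ b = rk a' - 1" "deg_vec (E - D) $ b = rk b' - rk a' + 1"
      using I by auto
    have "deg_vec D $ y = rk a \<and> deg_vec (E - D) $ y = rk b - rk a + 1" if y: "y \<in> J" for y
    proof -
      have "a < y" "b < y" "a \<in> I" "b \<in> I" using y disjoint I J by auto
      then have F: "{a, y} \<in> E - D" "{b, y} \<in> E - D" using edges[of a y] edges[of b y] y by auto
      have "deg_vec D $ y \<le> rk a"
        using shifted_nonedge_bounds(1)[OF D \<open>a < y\<close>] F by simp
      moreover have "rk b + 1 \<le> deg_vec E $ y"
        using shifted_edge_bounds(1)[OF E \<open>b < y\<close>] F by simp
      moreover have "deg_vec (E - D) $ y = rk b - rk a + 1"
      proof -
        have "I - {y} = I" "y \<notin> I" using y disjoint by auto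
        then have "nbrs (E - D) y = I" using y nbrs_diff[of y] by simp
        then show ?thesis
          using card_interval_rk[OF I(2)] I(1) by (simp add: deg_vec_eq_card_nbrs[OF sg(3)])
      qed
      ultimately show ?thesis by (simp add: deg_E)
    qed
    from this[of a'] this[of b']
    have j: "deg_vec D $ a' = rk a" "deg_vec (E - D) $ a' = rk b - rk a + 1"
        "deg_vec D $ b' = rk a" "deg_vec (E - D) $ b' = rk b - rk a + 1"
      using J by auto
    show ?thesis using i j by (simp add: deg_E)
  qed
  then show "deg_vec D $ a = deg_vec D $ b" "deg_vec D $ a' = deg_vec D $ b'"
    "deg_vec D $ a + deg_vec D $ a' + deg_vec D $ b + deg_vec D $ b'
     + deg_vec E $ a + deg_vec E $ a' + deg_vec E $ b + deg_vec E $ b'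
     = 2 * (rk a + rk a' + rk b + rk b')"
    by auto
qed

text \<open>
  Replacing the sum of the weights of \<open>D\<close> and \<open>E\<close> on each block by its values at the two ends makes
  it constant on \<open>I\<close> and on \<open>J\<close>; the two constants then add up to 0, so that edges of \<open>E - D\<close> do not
  count.
\<close>

definition mid_weight :: "'n \<Rightarrow> real" where
  "mid_weight x = shift_weight D x + shift_weight E x"

lemma mid_weight_pos: "{x, y} \<in> D \<Longrightarrow> mid_weight x + mid_weight y > 0"
  using shift_weight_pos[OF D, of x y] shift_weight_pos[OF E, of x y] DE
  by (force simp: mid_weight_def)

lemma mid_weight_neg: "{x, y} \<notin> E \<Longrightarrow> x \<noteq> y \<Longrightarrow> mid_weight x + mid_weight y < 0"
  using shift_weight_neg[OF D, of x y] shift_weight_neg[OF E, of x y] DE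
  by (force simp: mid_weight_def)

definition lower :: "'n \<Rightarrow> 'n" where
  "lower x = (if x \<in> I then a else if x \<in> J then a' else x)"

definition upper :: "'n \<Rightarrow> 'n" where
  "upper x = (if x \<in> I then b else if x \<in> J then b' else x)"

definition block_weight :: "'n \<Rightarrow> real" where
  "block_weight x = mid_weight (lower x) + mid_weight (upper x)"

lemma equiv_ends: "equiv x (lower x)" "equiv x (upper x)"
  using ends_mem by (auto simp: equiv_def lower_def upper_def)

text \<open>A block with two different vertices has two different ends. Pairing lower with upper
  ends therefore never turns an edge into a loop.\<close>

lemma lower_neq_upper: "x \<noteq> y \<Longrightarrow> lower x \<noteq> upper y"
  unfolding lower_def upper_def using ends_mem I J by (cases rule: block_cases) (auto split: if_splits)

lemma block_weight_pos:
  assumes "{x, y} \<in> D"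
  shows "block_weight x + block_weight y > 0"
proof -
  have "x \<noteq> y" using simple_graphD[OF sg(1)] assms by auto
  then have "{lower x, upper y} \<in> D" "{lower y, upper x} \<in> D"
    using replace_D[OF equiv_ends(1)[of x] equiv_ends(2)[of y] lower_neq_upper]
      replace_D[OF equiv_ends(1)[of y] equiv_ends(2)[of x] lower_neq_upper] assms
    by (auto simp: insert_commute)
  from this[THEN mid_weight_pos] show ?thesis by (simp add: block_weight_def)
qed

lemma block_weight_neg:
  assumes "{x, y} \<notin> E" "x \<noteq> y"
  shows "block_weight x + block_weight y < 0"
proof -
  have "{lower x, upper y} \<notin> E" "{lower y, upper x} \<notin> E"
    using replace_E[OF equiv_ends(1)[of x, THEN equiv_sym] equiv_ends(2)[of y, THEN equiv_sym]]
      replace_E[OF equiv_ends(1)[of y, THEN equiv_sym] equiv_ends(2)[of x, THEN equiv_sym]] assms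
    by (auto simp: insert_commute)
  then show ?thesis
    using mid_weight_neg[of "lower x" "upper y"] mid_weight_neg[of "lower y" "upper x"]
      lower_neq_upper[of x y] lower_neq_upper[of y x] assms(2) by (auto simp: block_weight_def)
qed

lemma block_weight_zero:
  assumes "{x, y} \<in> E - D"
  shows "block_weight x + block_weight y = 0"
proof -
  have *: "mid_weight a + mid_weight b + mid_weight a' + mid_weight b' = 0"
    using deg_D_ends(3) by (simp add: mid_weight_def shift_weight_def)
  show ?thesis using assms edges[of x y] *
    unfolding block_weight_def lower_def upper_def by (cases rule: block_cases) auto
qed

section \<open>Graphs between \<open>D\<close> and \<open>E\<close> with constant degrees on the
  blocks\<close>

lemma deg_const_on_block:
  assumes "z \<in> decreasing_vecs" "z $ a = z $ b" "z $ a' = z $ b'"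
  shows "x \<in> I \<Longrightarrow> z $ x = z $ a" "x \<in> J \<Longrightarrow> z $ x = z $ a'"
proof -
  have le: "i \<le> j \<Longrightarrow> z $ j \<le> z $ i" for i j using assms(1) by (simp add: decreasing_vecs_def)
  show "x \<in> I \<Longrightarrow> z $ x = z $ a" using le[of a x] le[of x b] assms(2) I(1) by simp
  show "x \<in> J \<Longrightarrow> z $ x = z $ a'" using le[of a' x] le[of x b'] assms(3) J(1) by simp
qed

text \<open>Each edge of \<open>H\<close> has one end counted in \<open>I\<close> and the other in
  \<open>J\<close>. The test vector is the difference of the two indicators; it is zero when
  \<open>I = J\<close>.\<close>

lemma sum_deg_blocks:
  assumes "H \<subseteq> E - D"
  shows "(\<Sum>k\<in>I. deg_vec H $ k) = (\<Sum>k\<in>J. deg_vec H $ k)"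
proof -
  define c :: "real ^ ('n::{finite,linorder})"
    where "c = (\<chi> k. (if k \<in> I then 1 else 0) - (if k \<in> J then 1 else 0))"
  have "c \<bullet> deg_vec H = (\<Sum>e\<in>H. \<Sum>k\<in>e. c $ k)" by (rule inner_deg_vec)
  also have "\<dots> = 0"
  proof (rule sum.neutral, rule ballI)
    fix e assume "e \<in> H"
    then have e: "e \<in> E - D" using assms by auto
    obtain x y where xy: "e = {x, y}" "x \<noteq> y" by (rule simple_graph_edgeE[OF sg(3) e])
    then have "(x \<in> I \<and> y \<in> J) \<or> (x \<in> J \<and> y \<in> I)" using edges[of x y] e by simp
    then have "c $ x + c $ y = 0" by (cases rule: block_cases) (auto simp: c_def)
    then show "(\<Sum>k\<in>e. c $ k) = 0" using xy by simp
  qed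
  moreover have "c \<bullet> deg_vec H = (\<Sum>k\<in>I. deg_vec H $ k) - (\<Sum>k\<in>J. deg_vec H $ k)"
    by (simp add: inner_vec_def c_def left_diff_distrib sum_subtractf if_distrib[of "\<lambda>x. x * _"]
        sum.If_cases cong: if_cong)
  ultimately show ?thesis by simp
qed

text \<open>The added part \<open>H\<close> has one degree on \<open>I\<close> and one on
  \<open>J\<close>. Double counting fixes their ratio, so the degree vector of \<open>H\<close> is a
  multiple of that of \<open>E - D\<close>, with factor between 0 and 1.\<close>

lemma segment_of_subgraph:
  assumes G: "D \<subseteq> G" "G \<subseteq> E" "deg_vec G \<in> decreasing_vecs"
    and const: "deg_vec G $ a = deg_vec G $ b" "deg_vec G $ a' = deg_vec G $ b'"
  shows "deg_vec G \<in> closed_segment (deg_vec D) (deg_vec E)"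
proof -
  define H where "H = G - D"
  have H: "H \<subseteq> E - D" using G by (auto simp: H_def)
  then have sgH: "simple_graph UNIV H" using sg(3) simple_graph_subset by blast
  have "deg_vec G = deg_vec D + deg_vec H"
    using deg_vec_Un[of D H] G by (simp add: H_def Un_absorb1)
  then have hG: "deg_vec H = deg_vec G - deg_vec D" by simp
  have D_dec: "deg_vec D \<in> decreasing_vecs" using D by (rule shifted_deg_vec_mem_decreasing)
  note cD = deg_const_on_block[OF D_dec deg_D_ends(1,2)]
  note cG = deg_const_on_block[OF G(3) const]
  define \<alpha> \<beta> A B where "\<alpha> = deg_vec H $ a" "\<beta> = deg_vec H $ a'"
    "A = deg_vec (E - D) $ a" "B = deg_vec (E - D) $ a'"
  have HI: "deg_vec H $ x = \<alpha>" if "x \<in> I" for x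
    using cD(1)[OF that] cG(1)[OF that] by (simp add: hG \<alpha>_\<beta>_A_B_def)
  have HJ: "deg_vec H $ x = \<beta>" if "x \<in> J" for x
    using cD(2)[OF that] cG(2)[OF that] by (simp add: hG \<alpha>_\<beta>_A_B_def)
  have FI: "deg_vec (E - D) $ x = A" if "x \<in> I" for x
    using that I by (cases rule: block_cases)
      (auto simp: deg_vec_eq_card_nbrs[OF sg(3)] nbrs_diff \<alpha>_\<beta>_A_B_def card_Diff_singleton_if)
  have FJ: "deg_vec (E - D) $ x = B" if "x \<in> J" for x
    using that J by (cases rule: block_cases)
      (auto simp: deg_vec_eq_card_nbrs[OF sg(3)] nbrs_diff \<alpha>_\<beta>_A_B_def card_Diff_singleton_if)
  have sub: "nbrs H x \<subseteq> nbrs (E - D) x" for x using H by (auto simp: nbrs_def)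
  have off: "deg_vec H $ x = 0" "deg_vec (E - D) $ x = 0" if "x \<notin> I" "x \<notin> J" for x
    using sub[of x] that by (auto simp: deg_vec_eq_card_nbrs sgH sg nbrs_diff)
  have le: "0 \<le> \<alpha>" "\<alpha> \<le> A"
    using sub[of a] by (auto simp: \<alpha>_\<beta>_A_B_def deg_vec_eq_card_nbrs sgH sg card_mono)
  have "nbrs (E - D) a \<noteq> {}" using I J by (cases rule: block_cases) (auto simp: nbrs_diff)
  then have "A > 0" by (auto simp: \<alpha>_\<beta>_A_B_def deg_vec_eq_card_nbrs sg card_gt_0_iff)
  have "card J > 0" using J by (auto simp: card_gt_0_iff)
  have *: "card I * \<alpha> = card J * \<beta>" "card I * A = card J * B"
    using sum_deg_blocks[OF H] sum_deg_blocks[OF subset_refl] HI HJ FI FJ by simp_all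
  then have "card J * (\<beta> * A) = card J * (\<alpha> * B)"
    by (metis mult.assoc mult.commute)
  then have "\<beta> * A = \<alpha> * B" using \<open>card J > 0\<close> by auto
  then have B: "\<beta> = (\<alpha> / A) * B" using \<open>A > 0\<close> by (simp add: field_simps)
  have "deg_vec H $ x = (\<alpha> / A) * deg_vec (E - D) $ x" for x
    using HI[of x] HJ[of x] FI[of x] FJ[of x] off[of x] B \<open>A > 0\<close>
    by (cases "x \<in> I"; cases "x \<in> J") auto
  then have "deg_vec H = (\<alpha> / A) *\<^sub>R deg_vec (E - D)" by (simp add: vec_eq_iff)
  then have "deg_vec G = (1 - \<alpha> / A) *\<^sub>R deg_vec D + (\<alpha> / A) *\<^sub>R deg_vec E"
    using hG by (simp add: deg_E algebra_simps)
  moreover have "0 \<le> \<alpha> / A" "\<alpha> / A \<le> 1" using le \<open>A > 0\<close> by auto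
  ultimately show ?thesis by (auto simp: in_segment)
qed

text \<open>The block weights are maximised exactly by the graphs between \<open>D\<close> and
  \<open>E\<close>; the penalties keep those with constant degrees on the blocks, whose degree
  vectors lie on the segment.\<close>

lemma segment_edge_of_DP: "closed_segment (deg_vec D) (deg_vec E) edge_of DP"
proof -
  define U :: "real ^ ('n::{finite,linorder})" where "U = (\<chi> k. block_weight k)"
  \<comment> \<open>On decreasing vectors the subtracted terms are penalties for not being constant on a block.\<close>
  define c :: "real ^ ('n::{finite,linorder})"
    where "c = U - (axis a 1 - axis b 1) - (axis a' 1 - axis b' 1)"
  have c: "c \<bullet> x = U \<bullet> x - (x $ a - x $ b) - (x $ a' - x $ b')" for x
    by (simp add: c_def inner_diff_left inner_axis')
  have pos: "(\<Sum>k\<in>e. U $ k) > 0" if e: "e \<in> D" for e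
  proof -
    obtain x y where "e = {x, y}" "x \<noteq> y" by (rule simple_graph_edgeE[OF sg(1) e])
    then show ?thesis using block_weight_pos[of x y] e by (simp add: U_def)
  qed
  have zero: "(\<Sum>k\<in>e. U $ k) = 0" if e: "e \<in> E - D" for e
  proof -
    obtain x y where "e = {x, y}" "x \<noteq> y" by (rule simple_graph_edgeE[OF sg(3) e])
    then show ?thesis using block_weight_zero[of x y] e by (simp add: U_def)
  qed
  have neg: "(\<Sum>k\<in>e. U $ k) < 0" if G: "simple_graph UNIV G" and e: "e \<in> G" "e \<notin> E" for e G
  proof -
    obtain x y where "e = {x, y}" "x \<noteq> y" by (rule simple_graph_edgeE[OF G e(1)])
    then show ?thesis using block_weight_neg[of x y] e by (simp add: U_def)
  qed
  have nonpos: "(\<Sum>k\<in>e. U $ k) \<le> 0" if "simple_graph UNIV G" "e \<in> G - D" for e G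
    using neg[OF that(1), of e] zero[of e] that(2) by (cases "e \<in> E") auto
  have opt: "U \<bullet> deg_vec G \<le> U \<bullet> deg_vec D" if "simple_graph UNIV G" for G
    unfolding inner_deg_vec
    by (rule sum_le_sum_positive_part) (auto intro: less_imp_le pos nonpos[OF that])
  have pen: "x $ a - x $ b \<ge> 0" "x $ a' - x $ b' \<ge> 0" if "x \<in> decreasing_vecs" for x :: "real ^ ('n::{finite,linorder})"
    using that I J by (auto simp: decreasing_vecs_def)
  have le: "c \<bullet> x \<le> U \<bullet> deg_vec D" if "x \<in> sorted_degree_vecs" for x
    using that opt pen unfolding c sorted_degree_vecs_def by fastforce
  have UE: "U \<bullet> deg_vec (E - D) = 0" unfolding inner_deg_vec by (rule sum.neutral) (use zero in auto)
  have cD: "c \<bullet> deg_vec D = U \<bullet> deg_vec D" using deg_D_ends by (simp add: c)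
  have endsF: "deg_vec (E - D) $ a = deg_vec (E - D) $ b" "deg_vec (E - D) $ a' = deg_vec (E - D) $ b'"
    using I J by (cases rule: block_cases;
        auto simp: deg_vec_eq_card_nbrs[OF sg(3)] nbrs_diff card_Diff_singleton_if)+
  have cE: "c \<bullet> deg_vec E = U \<bullet> deg_vec D"
    using deg_D_ends endsF by (simp add: c deg_E inner_add_right UE)
  obtain S where S: "S = {x \<in> sorted_degree_vecs. c \<bullet> x = U \<bullet> deg_vec D}"
      "(convex hull S) face_of DP"
    using exposed_face_DP[of c] le by blast
  have "S \<subseteq> closed_segment (deg_vec D) (deg_vec E)"
  proof
    fix x assume "x \<in> S"
    then obtain G where G: "x = deg_vec G" "simple_graph UNIV G" "deg_vec G \<in> decreasing_vecs"
      and max: "c \<bullet> deg_vec G = U \<bullet> deg_vec D"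
      by (auto simp: S(1) sorted_degree_vecs_def)
    \<comment> \<open>The optimality bound and both penalties must be tight at once.\<close>
    have UG: "U \<bullet> deg_vec G = U \<bullet> deg_vec D"
      and const: "deg_vec G $ a = deg_vec G $ b" "deg_vec G $ a' = deg_vec G $ b'"
      using max opt[OF G(2)] pen[OF G(3)] unfolding c by linarith+
    have "(\<Sum>k\<in>e. U $ k) = 0" if "e \<in> (D - G) \<union> (G - D)" for e
      by (rule sum_le_sum_positive_part(2)[OF _ _ _ _ UG[unfolded inner_deg_vec] that])
        (auto intro: less_imp_le pos nonpos[OF G(2)])
    then have "D \<subseteq> G" "G \<subseteq> E" using pos neg[OF G(2)] DE by fastforce+
    then show "x \<in> closed_segment (deg_vec D) (deg_vec E)"
      unfolding G(1) using segment_of_subgraph G(3) const by blast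
  qed
  moreover have "{deg_vec D, deg_vec E} \<subseteq> S"
    using cD cE shifted_mem_sorted_degree_vecs D E by (auto simp: S(1))
  ultimately have "convex hull S = closed_segment (deg_vec D) (deg_vec E)"
    by (metis convex_closed_segment hull_minimal hull_mono segment_convex_hull subset_antisym)
  moreover have "deg_vec D \<noteq> deg_vec E"
  proof
    assume "deg_vec D = deg_vec E"
    then have "deg_vec (E - D) = 0" by (simp add: deg_E)
    \<comment> \<open>In both cases \<open>a\<close> and \<open>b'\<close> are joined by an added
      edge, so the segment is not a point.\<close>
    moreover have "a \<in> I" "b' \<in> J" "a \<noteq> b'" using I J by (auto, cases rule: block_cases) auto
    then have "deg_vec (E - D) $ a > 0" using deg_vec_pos[OF sg(3)] edges[of a b'] by blast
    ultimately show False by simp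
  qed
  ultimately show ?thesis using S(2) by (simp add: edge_of_def segment_convex_hull aff_dim_convex_hull aff_dim_2)
qed

end

section \<open>From differences of degree vectors to edges, and the equivalence\<close>

lemma Omega_imp_edge_of:
  fixes D E :: "('n::{finite,linorder}) set set"
  assumes D: "shifted D" and E: "shifted E" and le: "deg_vec D \<le> deg_vec E"
    and Omega: "(\<exists>I. nontrivial_interval I \<and> deg_vec E - deg_vec D = Omega1 I) \<or>
     (\<exists>I J. disjoint_interval_pair I J \<and> deg_vec E - deg_vec D = Omega2 I J)"
  shows "closed_segment (deg_vec D) (deg_vec E) edge_of DP"
proof -
  have DE: "D \<subseteq> E" using shifted_deg_vec_le_imp_subset[OF D E le] .
  have F: "deg_vec E - deg_vec D = deg_vec (E - D)"
    using deg_vec_Un[of D "E - D"] DE by (simp add: Un_absorb1)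
  have sgF: "simple_graph UNIV (E - D)" using E by (auto simp: shifted_def intro: simple_graph_subset)
  from Omega show ?thesis unfolding F
  proof (elim disjE exE conjE)
    fix I assume I: "nontrivial_interval I" "deg_vec (E - D) = Omega1 I"
    then obtain a b where ab: "a \<le> b" "I = {a..b}" "card I \<ge> 2"
      by (auto simp: nontrivial_interval_def index_interval_def)
    then have "a < b" by (cases "a = b") auto
    have edges: "{x, y} \<in> E - D \<longleftrightarrow> x \<noteq> y \<and> ((x \<in> I \<and> y \<in> I) \<or> (x \<in> I \<and> y \<in> I))" for x y
      unfolding edges_of_Omega1[OF sgF I(2)] by blast
    have "block_step D E I I a b a b"
      by (rule block_step.intro[OF D E DE ab(2,1) ab(2,1) edges]) (use \<open>a < b\<close> in blast)
    then show ?thesis by (rule block_step.segment_edge_of_DP)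
  next
    fix I J assume IJ: "disjoint_interval_pair I J" "deg_vec (E - D) = Omega2 I J"
    then obtain a b a' b' where ab: "a \<le> b" "I = {a..b}" "a' \<le> b'" "J = {a'..b'}" "Max I < Min J"
      unfolding disjoint_interval_pair_def index_interval_def by blast
    have less: "i < j" if "i \<in> I" "j \<in> J" for i j
      using that ab(5) by (meson Max_ge Min_le finite le_less_trans less_le_trans)
    have "b < a'" using less[of b a'] ab(1-4) by simp
    have edges: "{x, y} \<in> E - D \<longleftrightarrow> x \<noteq> y \<and> ((x \<in> I \<and> y \<in> J) \<or> (x \<in> J \<and> y \<in> I))" for x y
      using edges_of_Omega2[OF D E IJ(2) less, of x y] less[of x x] less_irrefl by blast
    have "block_step D E I J a b a' b'"
      by (rule block_step.intro[OF D E DE ab(2,1) ab(4,3) edges]) (use \<open>b < a'\<close> in blast)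
    then show ?thesis by (rule block_step.segment_edge_of_DP)
  qed
qed

theorem theorem5p3:
  fixes d e :: "real ^ ('n::{finite,linorder})"
  assumes "CARD('n) \<ge> 3"
    and "d \<in> TP" and "e \<in> TP"
  shows "adjacent_extreme_points DP d e \<longleftrightarrow>
    (d \<le> e \<or> e \<le> d) \<and>
    ((\<exists>I. nontrivial_interval I \<and> \<bar>d - e\<bar> = Omega1 I) \<or>
     (\<exists>I J. disjoint_interval_pair I J \<and> \<bar>d - e\<bar> = Omega2 I J))"
proof -
  obtain D where D: "shifted D" "d = deg_vec D" using TP_imp_shifted[OF assms(2)] .
  obtain E where E: "shifted E" "e = deg_vec E" using TP_imp_shifted[OF assms(3)] .
  have abs_le: "\<bar>x - y\<bar> = y - x" "\<bar>y - x\<bar> = y - x" if "x \<le> y" for x y :: "real ^ ('n::{finite,linorder})"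
    using that by (auto simp: vec_eq_iff less_eq_vec_def abs_vec_def)
  \<comment> \<open>Both points are extreme already, so only the edge condition remains.\<close>
  have "adjacent_extreme_points DP d e \<longleftrightarrow> closed_segment d e edge_of DP"
    using shifted_extreme_point_DP D E by (auto simp: adjacent_extreme_points_def)
  moreover have "closed_segment d e edge_of DP" if "d \<le> e"
    "(\<exists>I. nontrivial_interval I \<and> \<bar>d - e\<bar> = Omega1 I) \<or>
     (\<exists>I J. disjoint_interval_pair I J \<and> \<bar>d - e\<bar> = Omega2 I J)"
    using Omega_imp_edge_of[OF D(1) E(1)] that D(2) E(2) abs_le by simp
  moreover have "closed_segment d e edge_of DP" if "e \<le> d"
    "(\<exists>I. nontrivial_interval I \<and> \<bar>d - e\<bar> = Omega1 I) \<or>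
     (\<exists>I J. disjoint_interval_pair I J \<and> \<bar>d - e\<bar> = Omega2 I J)"
    using Omega_imp_edge_of[OF E(1) D(1)] that D(2) E(2) abs_le by (simp add: closed_segment_commute)
  moreover have "(d \<le> e \<or> e \<le> d) \<and> ((\<exists>I. nontrivial_interval I \<and> \<bar>d - e\<bar> = Omega1 I) \<or>
     (\<exists>I J. disjoint_interval_pair I J \<and> \<bar>d - e\<bar> = Omega2 I J))"
    if edge: "closed_segment d e edge_of DP"
  proof -
    obtain x y where xy: "{d, e} = {x, y}" "x \<le> y"
      "(\<exists>I. nontrivial_interval I \<and> y - x = Omega1 I) \<or>
       (\<exists>I J. disjoint_interval_pair I J \<and> y - x = Omega2 I J)"
    proof -
      have "d \<in> sorted_degree_vecs" "e \<in> sorted_degree_vecs"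
        using shifted_mem_sorted_degree_vecs D E by auto
      from adjacent_imp_Omega[OF this edge] that show thesis by (elim exE conjE)
    qed
    have "\<bar>d - e\<bar> = y - x" "d \<le> e \<or> e \<le> d"
      using xy(1,2) abs_le by (auto simp: doubleton_eq_iff)
    with xy(3) show ?thesis by simp
  qed
  ultimately show ?thesis by blast
qed

end
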